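(* There exists a Lipschitz path differentiable function $g\colon\mathbb{R}^2\to\mathbb{R}$ such that: (1) for all $x\in[0,1]$, $\max_{y\in\mathbb{R}}g(x,y)=x$ and the maximum is attained on $[0,1]$; (2) for all $x\in[0,1]$, $0\in\{v\in\mathbb{R}:\ (v,0)\in\partial^cg(x,y)\text{ for some }y\in\arg\max_{z\in\mathbb{R}}g(x,z)\}$; (3) for countably many $x\in[0,1]$, $\arg\max_{y\in\mathbb{R}}g(x,y)$ is a pair (exactly two points), and for all the other $x\in[0,1]$ it is a singleton.
   Context: $\partial^c g$ is the Clarke subdifferential: for a locally Lipschitz $h\colon\mathbb{R}^n\to\mathbb{R}$ with full-measure differentiability set $R$, $\partial^ch(z)$ is the convex hull of all limits $\lim_k\nabla h(z_k)$ with $z_k\in R$, $z_k\to z$. A locally Lipschitz function $f\colon\mathbb{R}^p\to\mathbb{R}$ is path differentiable if there is a set-valued map $D\colon\mathbb{R}^p\rightrightarrows\mathbb{R}^p$ with closed graph and nonempty, locally bounded values (bounded uniformly over each compact set) such that for all $x\in\mathbb{R}^p$, all absolutely continuous $\gamma\colon[0,1]\to\mathbb{R}^p$ with $\gamma(0)=0$, $\gamma(1)=x$, and all measurable $v\colon[0,1]\to\mathbb{R}^p$ with $v(t)\in D(\gamma(t))$ for all $t\in[0,1]$, one has $f(x)=f(0)+\int_0^1\langle\dot\gamma(t),v(t)\rangle\,dt$. *)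

theory Defs
  imports "HOL-Analysis.Analysis"
begin

definition locally_Lipschitz :: "('a::metric_space \<Rightarrow> 'b::metric_space) \<Rightarrow> bool" where
  "locally_Lipschitz f \<longleftrightarrow> (\<forall>x. \<exists>e>0. \<exists>L. L-lipschitz_on (ball x e) f)"

definition abs_continuous_on_interval ::
    "real \<Rightarrow> real \<Rightarrow> (real \<Rightarrow> 'a::real_normed_vector) \<Rightarrow> bool" where
  "abs_continuous_on_interval a b \<gamma> \<longleftrightarrow>
     (\<forall>e>0. \<exists>d>0. \<forall>(n::nat) (l::nat \<Rightarrow> real) (u::nat \<Rightarrow> real).
        (\<forall>i<n. a \<le> l i \<and> l i \<le> u i \<and> u i \<le> b) \<longrightarrow>
        disjoint_family_on (\<lambda>i. {l i<..<u i}) {..<n} \<longrightarrow>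
        (\<Sum>i<n. u i - l i) < d \<longrightarrow>
        (\<Sum>i<n. norm (\<gamma> (u i) - \<gamma> (l i))) < e)"

(* GDERIV h z :> d says that h is (Frechet) differentiable at z with gradient d, so the
   sequences zs range over the set of all differentiability points of h. *)
definition clarke_subdifferential ::
    "('a::euclidean_space \<Rightarrow> real) \<Rightarrow> 'a \<Rightarrow> 'a set" where
  "clarke_subdifferential h z =
     convex hull {v. \<exists>zs ds. (\<forall>k::nat. GDERIV h (zs k) :> ds k) \<and>
                        zs \<longlonglongrightarrow> z \<and> ds \<longlonglongrightarrow> v}"

(* An absolutely continuous curve is differentiable almost everywhere, so the arbitrary value
   of vector_derivative at the remaining points does not affect the integral.  The integrand is
   always integrable, since v is bounded on {0..1} and the derivative of the curve is integrable.
   Measurability of v is Lebesgue measurability. *)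
definition path_differentiable :: "('a::euclidean_space \<Rightarrow> real) \<Rightarrow> bool" where
  "path_differentiable f \<longleftrightarrow>
     locally_Lipschitz f \<and>
     (\<exists>D :: 'a \<Rightarrow> 'a set.
        closed {(x, v). v \<in> D x} \<and>
        (\<forall>x. D x \<noteq> {}) \<and>
        (\<forall>K. compact K \<longrightarrow> bounded (\<Union>x\<in>K. D x)) \<and>
        (\<forall>x \<gamma> v.
           abs_continuous_on_interval 0 1 \<gamma> \<longrightarrow> \<gamma> 0 = 0 \<longrightarrow> \<gamma> 1 = x \<longrightarrow>
           v \<in> borel_measurable (lebesgue_on {0..1}) \<longrightarrow>
           (\<forall>t\<in>{0..1}. v t \<in> D (\<gamma> t)) \<longrightarrow>
           f x = f 0 +
             (LINT t:{0..1}|lebesgue. vector_derivative \<gamma> (at t within {0..1}) \<bullet> v t)))"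

definition argmax_set :: "('a \<Rightarrow> real) \<Rightarrow> 'a set" where
  "argmax_set f = {y. is_arg_max f (\<lambda>_. True) y}"

end

theory Submission
  imports Defs
begin

text \<open>
  Let \<open>A\<close> be the Cantor set of the numbers \<open>\<Sum>k. e k / 4 ^ (k + 1)\<close> with digits \<open>e k \<in> {0, 1}\<close>, and let
  \<open>d\<close> be the distance to \<open>A\<close>.  The function is \<open>g (x, y) = x - 2 * d ((x - y) / 2) - d y\<close>.

  Clearly \<open>g (x, y) \<le> x\<close>, with equality iff both \<open>y\<close> and \<open>(x - y) / 2\<close> lie in \<open>A\<close>, that is, iff
  \<open>x = 2 * a + y\<close> with \<open>a, y \<in> A\<close>.  Adding digits, such decompositions of \<open>x\<close> are the same thing as
  base 4 expansions of \<open>x\<close>: the digits \<open>0, 1, 2, 3\<close> are the numbers \<open>2 * e + f\<close> with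
  \<open>e, f \<in> {0, 1}\<close>.  So there is at least one maximiser for each \<open>x \<in> [0, 1]\<close>, there are never more
  than two, and two occur only for numbers with a finite expansion, which form a countable set.  They do
  occur for all numbers \<open>1 / 4 ^ (n + 1)\<close>.

  The gradient of \<open>g\<close> is \<open>(1 - d' a, d' a - d' y)\<close> with \<open>a = (x - y) / 2\<close>.  As \<open>A\<close> has empty interior,
  each of its points is a limit of points at which \<open>d' = 1\<close>, namely points in a gap of \<open>A\<close> close to its
  left end.  Choosing \<open>a\<close> and \<open>y\<close> of this kind gives points with \<open>\<nabla>g = 0\<close> that converge to any given
  maximiser.

  Path differentiability is where the measure of \<open>A\<close> matters: \<open>A\<close> is null, so a function \<open>u\<close> of
  one real variable has derivative zero at almost every \<open>t\<close> with \<open>u t \<in> A\<close> and \<open>u\<close> differentiable.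
  At such \<open>t\<close> the chain rule for \<open>d \<circ> u\<close> holds with any slope at all, and at the other \<open>t\<close> it
  holds with the slopes pointing away from a nearest point of \<open>A\<close>
  (\<open>distance_slopes_chain_rule\<close>).  Applying this to the two coordinates \<open>(x - y) / 2\<close> and \<open>y\<close>
  along an absolutely continuous curve and integrating yields the conservative field of \<open>g\<close>.  There is no
  conflict with \<open>g (x, y) = x\<close> on the set of maximisers, on which the field contains \<open>0\<close>:
  this set is a linear image of \<open>A \<times> A\<close>, so absolutely continuous curves have velocity zero at almost
  every time that they spend in it.

  Integrating requires the fundamental theorem of calculus for absolutely continuous functions
  (\<open>abs_continuous_fundamental_theorem\<close>).  Its proof writes the function as the difference of two
  monotone absolutely continuous functions, obtains densities of their Stieltjes measures from the
  Radon-Nikodym theorem, and differentiates the integrals of these densities.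
\<close>

section \<open>Positive variation of an absolutely continuous function\<close>

text \<open>
  The index type is arbitrary: indexing by intervals, or by pairs of indices, saves renumbering.
\<close>

definition interval_family :: "real \<Rightarrow> real \<Rightarrow> 'i set \<Rightarrow> ('i \<Rightarrow> real) \<Rightarrow> ('i \<Rightarrow> real) \<Rightarrow> bool" where
  "interval_family a b I l u \<longleftrightarrow> finite I \<and> (\<forall>i\<in>I. a \<le> l i \<and> l i \<le> u i \<and> u i \<le> b) \<and>
     disjoint_family_on (\<lambda>i. {l i<..<u i}) I"

lemma interval_family_reindex:
  assumes "interval_family a b I l u" and "bij_betw h J I"
  shows "interval_family a b J (l \<circ> h) (u \<circ> h)"
proof -
  have "finite J" using assms bij_betw_finite unfolding interval_family_def by blast
  moreover have "h j \<in> I" if "j \<in> J" for j using assms(2) that bij_betwE by blast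
  moreover have "h j \<noteq> h k" if "j \<in> J" "k \<in> J" "j \<noteq> k" for j k
    using assms(2) that unfolding bij_betw_def inj_on_def by blast
  ultimately show ?thesis using assms(1)
    unfolding interval_family_def disjoint_family_on_def by simp
qed

lemma abs_continuous_on_intervalD:
  assumes "abs_continuous_on_interval a b f" and "e > 0"
  shows "\<exists>d>0. \<forall>(I :: 'i set) l u. interval_family a b I l u \<longrightarrow> (\<Sum>i\<in>I. u i - l i) < d
           \<longrightarrow> (\<Sum>i\<in>I. norm (f (u i) - f (l i))) < e"
proof -
  obtain d where d: "d > 0" and D: "\<And>n l u. \<lbrakk>\<forall>i<n. a \<le> l i \<and> l i \<le> u i \<and> u i \<le> b;
      disjoint_family_on (\<lambda>i. {l i<..<u i}) {..<n}; (\<Sum>i<n. u i - l i) < d\<rbrakk>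
      \<Longrightarrow> (\<Sum>i<n::nat. norm (f (u i) - f (l i))) < e"
    using assms unfolding abs_continuous_on_interval_def by blast
  show ?thesis
  proof (intro exI[of _ d] conjI d allI impI)
    fix I and l u :: "'i \<Rightarrow> real"
    assume fam: "interval_family a b I l u" and len: "(\<Sum>i\<in>I. u i - l i) < d"
    obtain h where h: "bij_betw h {..<card I} I"
      using fam bij_betw_from_nat_into_finite unfolding interval_family_def by blast
    have "(\<Sum>i<card I. norm (f ((u \<circ> h) i) - f ((l \<circ> h) i))) < e"
    proof (rule D)
      show "\<forall>i<card I. a \<le> (l \<circ> h) i \<and> (l \<circ> h) i \<le> (u \<circ> h) i \<and> (u \<circ> h) i \<le> b"
        "disjoint_family_on (\<lambda>i. {(l \<circ> h) i<..<(u \<circ> h) i}) {..<card I}"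
        using interval_family_reindex[OF fam h] unfolding interval_family_def by auto
      show "(\<Sum>i<card I. (u \<circ> h) i - (l \<circ> h) i) < d"
        using len sum.reindex_bij_betw[OF h, of "\<lambda>i. u i - l i"] by simp
    qed
    then show "(\<Sum>i\<in>I. norm (f (u i) - f (l i))) < e"
      using sum.reindex_bij_betw[OF h, of "\<lambda>i. norm (f (u i) - f (l i))"] by simp
  qed
qed

text \<open>
  The total length is the measure of the union, which lies in \<open>{a..b}\<close>.
\<close>

lemma interval_family_length:
  assumes "interval_family a b I l u" and "a \<le> b"
  shows "(\<Sum>i\<in>I. u i - l i) \<le> b - a"
proof -
  have fin: "finite I" and lu: "\<And>i. i \<in> I \<Longrightarrow> a \<le> l i \<and> l i \<le> u i \<and> u i \<le> b"
    and dis: "disjoint_family_on (\<lambda>i. {l i<..<u i}) I"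
    using assms unfolding interval_family_def by auto
  have "(\<Sum>i\<in>I. u i - l i) = (\<Sum>i\<in>I. measure lborel {l i<..<u i})"
    using lu by (intro sum.cong) auto
  also have "\<dots> = measure lborel (\<Union>i\<in>I. {l i<..<u i})"
    using lu by (intro measure_finite_Union[symmetric] fin dis) auto
  also have "\<dots> \<le> measure lborel {a..b}"
  proof (rule measure_mono_fmeasurable)
    show "(\<Union>i\<in>I. {l i<..<u i}) \<subseteq> {a..b}" using lu by force
    show "(\<Union>i\<in>I. {l i<..<u i}) \<in> sets lborel" using fin by (intro sets.finite_UN) auto
    show "{a..b} \<in> fmeasurable lborel" by (intro fmeasurableI) (auto simp: emeasure_lborel_Icc_eq)
  qed
  finally show ?thesis using assms(2) by simp
qed

text \<open>
  The net increments of \<open>f\<close> over finite families of non-overlapping subintervals of \<open>{a..t}\<close>.  Their supremum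
  is the positive variation of \<open>f\<close>: falling parts can be left out of a family.
\<close>

definition rises :: "(real \<Rightarrow> real) \<Rightarrow> real \<Rightarrow> real \<Rightarrow> real set" where
  "rises f a t = {\<Sum>i<n. f (u i) - f (l i) | (n::nat) l u. interval_family a t {..<n} l u}"

definition positive_variation :: "(real \<Rightarrow> real) \<Rightarrow> real \<Rightarrow> real \<Rightarrow> real" where
  "positive_variation f a t = Sup (rises f a t)"

lemma risesE:
  assumes "r \<in> rises f a t"
  obtains n :: nat and l u where "interval_family a t {..<n} l u" "r = (\<Sum>i<n. f (u i) - f (l i))"
  using assms unfolding rises_def by blast

lemma risesI:
  "interval_family a t {..<n::nat} l u \<Longrightarrow> (\<Sum>i<n. f (u i) - f (l i)) \<in> rises f a t"
  unfolding rises_def by blast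

lemma zero_in_rises: "0 \<in> rises f a t"
  unfolding rises_def interval_family_def
  by (rule CollectI, rule exI[of _ 0]) (auto simp: disjoint_family_on_def)

lemma rises_mono:
  assumes "s \<le> t"
  shows "rises f a s \<subseteq> rises f a t"
proof
  fix r assume "r \<in> rises f a s"
  then obtain n :: nat and l u where fam: "interval_family a s {..<n} l u" and r: "r = (\<Sum>i<n. f (u i) - f (l i))"
    by (rule risesE)
  have "interval_family a t {..<n} l u"
    using fam assms unfolding interval_family_def by force
  then show "r \<in> rises f a t" unfolding r by (rule risesI)
qed

text \<open>
  The interval \<open>{s..t}\<close> can be added to any family inside \<open>{a..s}\<close>.  This is why both the
  positive variation and its difference with \<open>f\<close> are monotone.
\<close>

lemma rises_append:
  assumes "r \<in> rises f a s" "a \<le> s" "s \<le> t"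
  shows "r + (f t - f s) \<in> rises f a t"
proof -
  obtain n :: nat and l u where fam: "interval_family a s {..<n} l u" and r: "r = (\<Sum>i<n. f (u i) - f (l i))"
    using risesE[OF assms(1)] by blast
  have fam': "interval_family a t {..<Suc n} (l(n:=s)) (u(n:=t))"
    unfolding interval_family_def
  proof (intro conjI)
    show "\<forall>i\<in>{..<Suc n}. a \<le> (l(n := s)) i \<and> (l(n := s)) i \<le> (u(n := t)) i \<and> (u(n := t)) i \<le> t"
      using fam assms(2,3) unfolding interval_family_def by (force simp: less_Suc_eq)
    have bd: "u i \<le> s" if "i < n" for i using fam that unfolding interval_family_def by auto
    have dj: "{l i<..<u i} \<inter> {l j<..<u j} = {}" if "i < n" "j < n" "i \<noteq> j" for i j
      using fam that unfolding interval_family_def disjoint_family_on_def by auto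
    show "disjoint_family_on (\<lambda>i. {(l(n := s)) i<..<(u(n := t)) i}) {..<Suc n}"
      unfolding disjoint_family_on_def
    proof (intro ballI impI)
      fix i j assume "i \<in> {..<Suc n}" "j \<in> {..<Suc n}" "i \<noteq> j"
      then consider "i < n" "j < n" | "i = n" "j < n" | "i < n" "j = n" by force
      then show "{(l(n := s)) i<..<(u(n := t)) i} \<inter> {(l(n := s)) j<..<(u(n := t)) j} = {}"
        using dj \<open>i \<noteq> j\<close> bd[of i] bd[of j] by cases auto
    qed
  qed simp
  show ?thesis using risesI[OF fam', of f] r by simp
qed

text \<open>
  Cutting every interval of a family at \<open>s\<close> does not change the net increment, since the two parts of an
  interval contribute increments that telescope.  This bounds the growth of the positive variation over
  \<open>{s..t}\<close> by the families inside \<open>{s..t}\<close>.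
\<close>

lemma rises_split:
  assumes "r \<in> rises f a t" "a \<le> s" "s \<le> t"
  obtains r1 r2 where "r1 \<in> rises f a s" "r2 \<in> rises f s t" "r = r1 + r2"
proof -
  obtain n :: nat and l u where fam: "interval_family a t {..<n} l u" and r: "r = (\<Sum>i<n. f (u i) - f (l i))"
    using risesE[OF assms(1)] by blast
  have lu: "a \<le> l i \<and> l i \<le> u i \<and> u i \<le> t" if "i < n" for i
    using fam that unfolding interval_family_def by auto
  have dj: "{l i<..<u i} \<inter> {l j<..<u j} = {}" if "i < n" "j < n" "i \<noteq> j" for i j
    using fam that unfolding interval_family_def disjoint_family_on_def by auto
  let ?L = "\<lambda>f i. min (f i) s" and ?R = "\<lambda>f i. max (f i) s"
  have "interval_family a s {..<n} (?L l) (?L u)"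
    unfolding interval_family_def disjoint_family_on_def
  proof (intro conjI ballI impI)
    fix i j assume "i \<in> {..<n}" "j \<in> {..<n}" "i \<noteq> j"
    moreover have "{?L l i<..<?L u i} \<subseteq> {l i<..<u i}" for i by auto
    ultimately show "{?L l i<..<?L u i} \<inter> {?L l j<..<?L u j} = {}" using dj[of i j] by blast
  qed (use lu assms(2) in \<open>auto intro: min.coboundedI1\<close>)
  moreover have "interval_family s t {..<n} (?R l) (?R u)"
    unfolding interval_family_def disjoint_family_on_def
  proof (intro conjI ballI impI)
    fix i j assume "i \<in> {..<n}" "j \<in> {..<n}" "i \<noteq> j"
    moreover have "{?R l i<..<?R u i} \<subseteq> {l i<..<u i}" for i by auto
    ultimately show "{?R l i<..<?R u i} \<inter> {?R l j<..<?R u j} = {}" using dj[of i j] by blast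
  qed (use lu assms(3) in \<open>auto intro: max.coboundedI1\<close>)
  ultimately have fams: "interval_family a s {..<n} (?L l) (?L u)" "interval_family s t {..<n} (?R l) (?R u)" by auto
  have "r = (\<Sum>i<n. f (?L u i) - f (?L l i)) + (\<Sum>i<n. f (?R u i) - f (?R l i))"
    unfolding r sum.distrib[symmetric] by (intro sum.cong) (auto simp: min_def max_def)
  then show thesis using that[OF risesI[OF fams(1)] risesI[OF fams(2)]] by blast
qed

text \<open>
  Absolute continuity bounds the rises over a short interval by \<open>1\<close>, and finitely many short intervals
  cover \<open>{a..b}\<close>.
\<close>

lemma rises_bdd_above:
  assumes "abs_continuous_on_interval a b f" and "t \<le> b"
  shows "bdd_above (rises f a t)"
proof -
  obtain d where d: "d > 0" and D: "\<forall>(I :: nat set) l u. interval_family a b I l u \<longrightarrow>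
      (\<Sum>i\<in>I. u i - l i) < d \<longrightarrow> (\<Sum>i\<in>I. norm (f (u i) - f (l i))) < 1"
    using abs_continuous_on_intervalD[OF assms(1) zero_less_one] by blast
  have short: "r \<le> 1" if mem: "r \<in> rises f s t" and "a \<le> s" "s \<le> t" "t \<le> b" "t - s < d" for r s t
  proof -
    obtain n :: nat and l u where fam: "interval_family s t {..<n} l u" and r: "r = (\<Sum>i<n. f (u i) - f (l i))"
      using risesE[OF mem] by blast
    have "interval_family a b {..<n} l u"
      using fam that unfolding interval_family_def by force
    moreover have "(\<Sum>i<n. u i - l i) < d"
      using interval_family_length[OF fam] that by simp
    ultimately have "(\<Sum>i<n. norm (f (u i) - f (l i))) < 1" using D by blast
    moreover have "r \<le> (\<Sum>i<n. norm (f (u i) - f (l i)))"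
      unfolding r by (intro sum_mono) simp
    ultimately show ?thesis by simp
  qed
  \<comment> \<open>Steps of length \<open>d / 2\<close> are short enough, and each adds at most \<open>1\<close>.\<close>
  have main: "r \<le> real k" if "r \<in> rises f a t" "t \<le> a + real k * (d/2)" "t \<le> b" "a \<le> t" for k r t
    using that
  proof (induction k arbitrary: r t)
    case 0
    obtain n :: nat and l u where fam: "interval_family a t {..<n} l u"
      and r: "r = (\<Sum>i<n. f (u i) - f (l i))"
      using risesE[OF 0(1)] by blast
    have "l i = u i" if "i < n" for i using fam that 0 unfolding interval_family_def by force
    then show ?case using r by simp
  next
    case (Suc k)
    show ?case
    proof (cases "t \<le> a + real k * (d/2)")
      case True
      then show ?thesis using Suc.IH[of r t] Suc.prems by simp
    next
      case False
      define s where "s = a + real k * (d/2)"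
      have s: "a \<le> s" "s \<le> t" "t - s < d" "s \<le> b"
        using False d Suc.prems unfolding s_def by (auto simp: field_simps)
      obtain r1 r2 where r12: "r1 \<in> rises f a s" "r2 \<in> rises f s t" "r = r1 + r2"
        using rises_split[OF Suc.prems(1) s(1,2)] by blast
      have "r1 \<le> real k" using Suc.IH[OF r12(1)] s s_def by simp
      moreover have "r2 \<le> 1" using short[OF r12(2)] s Suc.prems by simp
      ultimately show ?thesis using r12 by simp
    qed
  qed
  show ?thesis
  proof (cases "a \<le> t")
    case True
    obtain k :: nat where "(t - a) / (d/2) \<le> real k" using real_arch_simple by blast
    then have "t \<le> a + real k * (d/2)" using d by (simp add: field_simps)
    then show ?thesis using main[of _ t k] assms(2) True by (meson bdd_aboveI)
  next
    case False
    have "r \<le> 0" if mem: "r \<in> rises f a t" for r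
    proof -
      obtain n :: nat and l u where fam: "interval_family a t {..<n} l u"
        and r: "r = (\<Sum>i<n. f (u i) - f (l i))"
        using risesE[OF mem] by blast
      have "n = 0" using fam False unfolding interval_family_def by force
      then show ?thesis using r by simp
    qed
    then show ?thesis by (meson bdd_aboveI)
  qed
qed

lemma positive_variation_mono:
  assumes "abs_continuous_on_interval a b f" "s \<le> t" "t \<le> b"
  shows "positive_variation f a s \<le> positive_variation f a t"
  unfolding positive_variation_def
  using rises_mono[OF assms(2)] rises_bdd_above[OF assms(1,3)] zero_in_rises[of f a s]
  by (intro cSup_subset_mono) auto

lemma positive_variation_increment_ge:
  assumes "abs_continuous_on_interval a b f" "a \<le> s" "s \<le> t" "t \<le> b"
  shows "positive_variation f a s + (f t - f s) \<le> positive_variation f a t"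
proof -
  have "r \<le> positive_variation f a t - (f t - f s)" if "r \<in> rises f a s" for r
    using cSup_upper[OF rises_append[OF that assms(2,3)] rises_bdd_above[OF assms(1,4)]]
    unfolding positive_variation_def by simp
  then have "positive_variation f a s \<le> positive_variation f a t - (f t - f s)"
    unfolding positive_variation_def[of f a s] using zero_in_rises[of f a s] by (intro cSup_least) auto
  then show ?thesis by simp
qed

lemma positive_variation_increment_less:
  assumes "abs_continuous_on_interval a b f" "a \<le> s" "s \<le> t" "t \<le> b" "e > 0"
  obtains r where "r \<in> rises f s t" "positive_variation f a t - positive_variation f a s < r + e"
proof -
  obtain r where r: "r \<in> rises f a t" "positive_variation f a t - e < r"
    using less_cSupE[of "positive_variation f a t - e" "rises f a t"] assms(5) zero_in_rises[of f a t]
    unfolding positive_variation_def by (metis diff_less_eq empty_iff less_add_same_cancel1)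
  obtain r1 r2 where r12: "r1 \<in> rises f a s" "r2 \<in> rises f s t" "r = r1 + r2"
    using rises_split[OF r(1) assms(2,3)] by blast
  have "r1 \<le> positive_variation f a s" unfolding positive_variation_def
    using r12(1) rises_bdd_above[OF assms(1), of s] assms by (intro cSup_upper) auto
  then show thesis using that[OF r12(2)] r12(3) r(2) by simp
qed

text \<open>
  For each interval of a given family, a family of subintervals nearly attains the increment of the positive
  variation.  All of these together form one family, to which the absolute continuity of \<open>f\<close> applies.
\<close>

lemma abs_continuous_positive_variation:
  assumes "abs_continuous_on_interval a b f"
  shows "abs_continuous_on_interval a b (positive_variation f a)"
  unfolding abs_continuous_on_interval_def
proof (intro allI impI)
  fix e :: real assume e: "e > 0"
  let ?P = "positive_variation f a"
  obtain d where d: "d > 0" and D: "\<forall>(I :: (nat \<times> nat) set) l u. interval_family a b I l u \<longrightarrow>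
      (\<Sum>i\<in>I. u i - l i) < d \<longrightarrow> (\<Sum>i\<in>I. norm (f (u i) - f (l i))) < e/2"
    using abs_continuous_on_intervalD[OF assms half_gt_zero[OF e]] by blast
  show "\<exists>d>0. \<forall>(n::nat) l u. (\<forall>i<n. a \<le> l i \<and> l i \<le> u i \<and> u i \<le> b) \<longrightarrow>
      disjoint_family_on (\<lambda>i. {l i<..<u i}) {..<n} \<longrightarrow> (\<Sum>i<n. u i - l i) < d \<longrightarrow>
      (\<Sum>i<n. norm (?P (u i) - ?P (l i))) < e"
  proof (intro exI[of _ d] conjI d allI impI)
    fix n :: nat and l u :: "nat \<Rightarrow> real"
    assume lu: "\<forall>i<n. a \<le> l i \<and> l i \<le> u i \<and> u i \<le> b"
      and dis: "disjoint_family_on (\<lambda>i. {l i<..<u i}) {..<n}" and len: "(\<Sum>i<n. u i - l i) < d"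
    \<comment> \<open>Each of the \<open>n\<close> intervals may lose \<open>e'\<close>, which costs at most \<open>e / 2\<close> altogether.\<close>
    define e' where "e' = e / (2 * (real n + 1))"
    have e': "e' > 0" using e unfolding e'_def by simp
    have ex: "\<exists>m l' u'. interval_family (l i) (u i) {..<m::nat} l' u' \<and>
        ?P (u i) - ?P (l i) < (\<Sum>j<m. f (u' j) - f (l' j)) + e'" if i: "i < n" for i
    proof -
      obtain r where "r \<in> rises f (l i) (u i)" "?P (u i) - ?P (l i) < r + e'"
        using positive_variation_increment_less[OF assms, of "l i" "u i" e'] lu i e' by metis
      then show ?thesis using risesE[of r f "l i" "u i"] by metis
    qed
    let ?Q = "\<lambda>i F. interval_family (l i) (u i) {..<fst F::nat} (fst (snd F)) (snd (snd F)) \<and>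
        ?P (u i) - ?P (l i) < (\<Sum>j<fst F. f (snd (snd F) j) - f (fst (snd F) j)) + e'"
    have "\<forall>i\<in>{..<n}. \<exists>F. ?Q i F"
    proof
      fix i assume "i \<in> {..<n}"
      then obtain m l' u' where "?Q i (m, l', u')" using ex[of i] by auto
      then show "\<exists>F. ?Q i F" by blast
    qed
    then obtain F where F: "\<forall>i\<in>{..<n}. ?Q i (F i)" by (rule bchoice[THEN exE])
    define m l' u' where "m = (\<lambda>i. fst (F i))" and "l' = (\<lambda>i. fst (snd (F i)))"
      and "u' = (\<lambda>i. snd (snd (F i)))"
    have fam: "interval_family (l i) (u i) {..<m i} (l' i) (u' i)"
      and inc: "?P (u i) - ?P (l i) < (\<Sum>j<m i. f (u' i j) - f (l' i j)) + e'" if "i < n" for i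
      using F that unfolding m_def l'_def u'_def by auto
    have bd: "l i \<le> l' i j \<and> l' i j \<le> u' i j \<and> u' i j \<le> u i" if "i < n" "j < m i" for i j
      using fam[OF that(1)] that(2) unfolding interval_family_def by auto
    let ?I = "SIGMA i:{..<n}. {..<m i}"
    have "(\<Sum>p\<in>?I. norm (f (case_prod u' p) - f (case_prod l' p))) < e/2"
    proof (rule D[rule_format])
      show "interval_family a b ?I (case_prod l') (case_prod u')"
        unfolding interval_family_def
      proof (intro conjI)
        show "\<forall>p\<in>?I. a \<le> case_prod l' p \<and> case_prod l' p \<le> case_prod u' p \<and> case_prod u' p \<le> b"
          using bd lu by (force split: prod.splits)
        show "disjoint_family_on (\<lambda>p. {case_prod l' p<..<case_prod u' p}) ?I"
          unfolding disjoint_family_on_def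
        proof (intro ballI impI)
          fix p q assume pq: "p \<in> ?I" "q \<in> ?I" "p \<noteq> q"
          obtain i j i' j' where p: "p = (i, j)" and q: "q = (i', j')"
            by (cases p, cases q) blast
          have *: "i < n" "j < m i" "i' < n" "j' < m i'" "i = i' \<longrightarrow> j \<noteq> j'"
            using pq unfolding p q by auto
          have "{l' i j<..<u' i j} \<inter> {l' i' j'<..<u' i' j'} = {}"
          proof (cases "i = i'")
            case True
            then show ?thesis using * fam[of i] unfolding interval_family_def disjoint_family_on_def
              by auto
          next
            case False
            have "{l i<..<u i} \<inter> {l i'<..<u i'} = {}"
              using False dis * unfolding disjoint_family_on_def by auto
            moreover have "{l' i j<..<u' i j} \<subseteq> {l i<..<u i}" "{l' i' j'<..<u' i' j'} \<subseteq> {l i'<..<u i'}"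
              using bd * by force+
            ultimately show ?thesis by blast
          qed
          then show "{case_prod l' p<..<case_prod u' p} \<inter> {case_prod l' q<..<case_prod u' q} = {}"
            unfolding p q by simp
        qed
      qed simp
      have "(\<Sum>p\<in>?I. case_prod u' p - case_prod l' p) = (\<Sum>i<n. \<Sum>j<m i. u' i j - l' i j)"
        by (simp add: sum.Sigma split_def)
      also have "\<dots> \<le> (\<Sum>i<n. u i - l i)"
        using lu by (intro sum_mono interval_family_length fam) auto
      finally show "(\<Sum>p\<in>?I. case_prod u' p - case_prod l' p) < d" using len by simp
    qed
    moreover have "(\<Sum>i<n. \<Sum>j<m i. f (u' i j) - f (l' i j))
        \<le> (\<Sum>i<n. \<Sum>j<m i. norm (f (u' i j) - f (l' i j)))"
      by (intro sum_mono) simp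
    moreover have "\<dots> = (\<Sum>p\<in>?I. norm (f (case_prod u' p) - f (case_prod l' p)))"
      by (simp add: sum.Sigma split_def)
    moreover have "(\<Sum>i<n. norm (?P (u i) - ?P (l i)))
        \<le> (\<Sum>i<n. (\<Sum>j<m i. f (u' i j) - f (l' i j)) + e')"
    proof (rule sum_mono)
      fix i assume "i \<in> {..<n}"
      then have "i < n" by simp
      then have "?P (l i) \<le> ?P (u i)" using lu by (intro positive_variation_mono[OF assms]) auto
      then show "norm (?P (u i) - ?P (l i)) \<le> (\<Sum>j<m i. f (u' i j) - f (l' i j)) + e'"
        using inc[OF \<open>i < n\<close>] by simp
    qed
    moreover have "real n * e' \<le> e/2" using e unfolding e'_def by (simp add: field_simps)
    ultimately show "(\<Sum>i<n. norm (?P (u i) - ?P (l i))) < e"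
      by (simp add: sum.distrib)
  qed
qed

section \<open>Densities of monotone absolutely continuous functions\<close>

lemma abs_continuous_imp_continuous_on:
  assumes "abs_continuous_on_interval a b f"
  shows "continuous_on {a..b} f"
  unfolding continuous_on_iff
proof (intro ballI allI impI)
  fix x e :: real assume x: "x \<in> {a..b}" and e: "e > 0"
  obtain d where d: "d > 0" and D: "\<forall>(I :: unit set) l u. interval_family a b I l u \<longrightarrow>
      (\<Sum>i\<in>I. u i - l i) < d \<longrightarrow> (\<Sum>i\<in>I. norm (f (u i) - f (l i))) < e"
    using abs_continuous_on_intervalD[OF assms e] by blast
  have "dist (f y) (f x) < e" if y: "y \<in> {a..b}" "dist y x < d" for y
  proof -
    have "interval_family a b {()} (\<lambda>_. min x y) (\<lambda>_. max x y)"
      using x y unfolding interval_family_def disjoint_family_on_def by auto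
    moreover have "(\<Sum>i\<in>{()}. max x y - min x y) < d" using y by (auto simp: dist_real_def)
    ultimately have "norm (f (max x y) - f (min x y)) < e" using D by fastforce
    then show ?thesis by (auto simp: dist_norm max_def min_def norm_minus_commute split: if_splits)
  qed
  then show "\<exists>d>0. \<forall>y\<in>{a..b}. dist y x < d \<longrightarrow> dist (f y) (f x) < e" using d by blast
qed

text \<open>
  Countable unions are limits of finite ones.
\<close>

lemma emeasure_Union_le_if_finite_sums_le:
  assumes "countable \<D>" and "\<D> \<subseteq> sets M"
    and "\<And>\<F>. finite \<F> \<Longrightarrow> \<F> \<subseteq> \<D> \<Longrightarrow> (\<Sum>K\<in>\<F>. emeasure M K) \<le> c"
  shows "emeasure M (\<Union>\<D>) \<le> c"
proof (cases "\<D> = {}")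
  case False
  define B where "B n = \<Union>(from_nat_into \<D> ` {..n::nat})" for n
  have r: "range (from_nat_into \<D>) = \<D>"
    using False assms(1) by (rule range_from_nat_into)
  have sub: "from_nat_into \<D> ` {..n} \<subseteq> \<D>" for n using r by auto
  have le: "emeasure M (B n) \<le> c" for n
  proof -
    have "emeasure M (\<Union>K\<in>from_nat_into \<D> ` {..n}. K) \<le> (\<Sum>K\<in>from_nat_into \<D> ` {..n}. emeasure M K)"
      using assms(2) sub by (intro emeasure_subadditive_finite) auto
    also have "\<dots> \<le> c" using assms(3) sub by auto
    finally show ?thesis unfolding B_def by simp
  qed
  have "(SUP n. emeasure M (B n)) = emeasure M (\<Union>n. B n)"
  proof (rule SUP_emeasure_incseq)
    show "range B \<subseteq> sets M"
      using assms(2) sub unfolding B_def by (blast intro!: sets.finite_Union)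
    show "incseq B" unfolding B_def incseq_def by fastforce
  qed
  moreover have "(\<Union>n. B n) = \<Union>(range (from_nat_into \<D>))" unfolding B_def by auto
  ultimately have "emeasure M (\<Union>\<D>) = (SUP n. emeasure M (B n))" unfolding r by simp
  also have "\<dots> \<le> c" using le by (rule SUP_least)
  finally show ?thesis .
qed simp

text \<open>
  A null set has a cover by countably many non-overlapping closed intervals inside an open set of small
  measure (\<open>covering_lemma\<close>).  Any finitely many of them form a family of small total length, so their
  Stieltjes measures have a small sum.  Extending \<open>F\<close> by constants outside of \<open>{a..b}\<close> makes its
  Stieltjes measure available.
\<close>

lemma absolutely_continuous_interval_measure:
  fixes F :: "real \<Rightarrow> real"
  assumes ab: "a \<le> b" and ac: "abs_continuous_on_interval a b F" and mono: "mono_on {a..b} F"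
  defines "G \<equiv> \<lambda>t. F (max a (min b t))"
  shows "absolutely_continuous lborel (interval_measure G)"
    and "mono G" and "continuous_on UNIV G"
proof -
  let ?cl = "\<lambda>t. max a (min b t)" and ?N = "interval_measure G"
  show monoG: "mono G"
    unfolding G_def using ab by (intro monoI mono_onD[OF mono]) auto
  show contG: "continuous_on UNIV G"
    unfolding G_def
    by (rule continuous_on_compose2[OF abs_continuous_imp_continuous_on[OF ac]])
       (use ab in \<open>auto intro!: continuous_intros\<close>)
  \<comment> \<open>Boundedness is needed for the cover only; null sets are countable unions of bounded ones.\<close>
  have bounded_null: "A \<in> null_sets ?N"
    if A: "A \<in> null_sets lborel" "A \<subseteq> cbox (- m) m" and m: "m > 0" for A m
  proof -
    have "emeasure ?N A \<le> ennreal e" if e: "e > 0" for e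
    proof -
      obtain d where d: "d > 0" and D: "\<forall>(I :: real set set) l u. interval_family a b I l u \<longrightarrow>
          (\<Sum>i\<in>I. u i - l i) < d \<longrightarrow> (\<Sum>i\<in>I. norm (F (u i) - F (l i))) < e"
        using abs_continuous_on_intervalD[OF ac e] by blast
      obtain U where U: "open U" "A \<subseteq> U" "emeasure lborel (U - A) < ennreal d"
        using outer_regular_lborel[of A d] A(1) d by (metis null_setsD2 sets_lborel)
      have eU: "emeasure lborel U < ennreal d"
        using U emeasure_Diff_null_set[OF A(1), of U] by simp
      have gauge: "gauge (\<lambda>x. if x \<in> U then U else UNIV)" using U(1) unfolding gauge_def by auto
      obtain \<D> where \<D>: "countable \<D>"
          "\<And>K. K \<in> \<D> \<Longrightarrow> interior K \<noteq> {} \<and> (\<exists>c d. K = cbox c d)"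
          "pairwise (\<lambda>A B. interior A \<inter> interior B = {}) \<D>"
          "\<And>K. K \<in> \<D> \<Longrightarrow> \<exists>x \<in> A \<inter> K. K \<subseteq> (if x \<in> U then U else UNIV)"
          "A \<subseteq> \<Union>\<D>"
        by (rule covering_lemma[OF A(2) _ gauge]) (use m in auto)
      have K: "K = {Inf K..Sup K} \<and> Inf K < Sup K \<and> interior K = {Inf K<..<Sup K} \<and> K \<subseteq> U" if KD: "K \<in> \<D>" for K
      proof -
        obtain c d where K: "K = {c..d}" and ne: "interior K \<noteq> {}" using \<D>(2)[OF KD] by auto
        then have "c < d" by (auto simp: interior_atLeastAtMost_real)
        moreover have "K \<subseteq> U"
        proof -
          obtain x where x: "x \<in> A" "K \<subseteq> (if x \<in> U then U else UNIV)" using \<D>(4)[OF KD] by blast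
          then have "x \<in> U" using U(2) by blast
          then show ?thesis using x(2) by simp
        qed
        ultimately show ?thesis using K by (simp add: interior_atLeastAtMost_real)
      qed
      have sum_le: "(\<Sum>K\<in>\<F>. emeasure ?N K) \<le> ennreal e" if F: "finite \<F>" "\<F> \<subseteq> \<D>" for \<F>
      proof -
        have KF: "K = {Inf K..Sup K} \<and> Inf K < Sup K \<and> interior K = {Inf K<..<Sup K} \<and> K \<subseteq> U"
          if "K \<in> \<F>" for K using K F(2) that by blast
        have dis: "{Inf K<..<Sup K} \<inter> {Inf L<..<Sup L} = {}" if KL: "K \<in> \<F>" "L \<in> \<F>" "K \<noteq> L" for K L
          using \<D>(3) KF[OF KL(1)] KF[OF KL(2)] KL F(2) unfolding pairwise_def by (metis subsetD)
        have "(\<Sum>K\<in>\<F>. Sup K - Inf K) = (\<Sum>K\<in>\<F>. measure lborel {Inf K<..<Sup K})"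
          using KF by (intro sum.cong) (auto simp: less_imp_le)
        also have "\<dots> = measure lborel (\<Union>K\<in>\<F>. {Inf K<..<Sup K})"
          using dis KF by (intro measure_finite_Union[symmetric] F(1))
             (auto simp: disjoint_family_on_def emeasure_lborel_Ioo less_imp_le)
        also have "\<dots> \<le> measure lborel U"
        proof (rule measure_mono_fmeasurable)
          have "{Inf K<..<Sup K} \<subseteq> U" if "K \<in> \<F>" for K
            using KF[OF that] by (metis greaterThanLessThan_subseteq_atLeastAtMost_iff order.trans order_refl)
          then show "(\<Union>K\<in>\<F>. {Inf K<..<Sup K}) \<subseteq> U" by blast
          show "(\<Union>K\<in>\<F>. {Inf K<..<Sup K}) \<in> sets lborel" using F(1) by (intro sets.finite_UN) auto
          show "U \<in> fmeasurable lborel"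
            using eU U(1) by (intro fmeasurableI) (auto intro: order.strict_trans)
        qed
        also have "\<dots> < d"
          using eU d by (metis emeasure_eq_ennreal_measure ennreal_less_iff measure_nonneg
              order.strict_trans ennreal_less_top less_irrefl)
        finally have len: "(\<Sum>K\<in>\<F>. Sup K - Inf K) < d" .
        have fam: "interval_family a b \<F> (\<lambda>K. ?cl (Inf K)) (\<lambda>K. ?cl (Sup K))"
          unfolding interval_family_def disjoint_family_on_def
        proof (intro conjI ballI impI F(1))
          fix K assume "K \<in> \<F>"
          then show "?cl (Inf K) \<le> ?cl (Sup K)" using KF[of K] by auto
        next
          fix K L assume KL: "K \<in> \<F>" "L \<in> \<F>" "K \<noteq> L"
          have "{?cl (Inf K)<..<?cl (Sup K)} \<subseteq> {Inf K<..<Sup K}" for K by auto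
          then show "{?cl (Inf K)<..<?cl (Sup K)} \<inter> {?cl (Inf L)<..<?cl (Sup L)} = {}"
            using dis[OF KL] by blast
        qed (use ab in auto)
        have "(\<Sum>K\<in>\<F>. ?cl (Sup K) - ?cl (Inf K)) \<le> (\<Sum>K\<in>\<F>. Sup K - Inf K)"
        proof (rule sum_mono)
          fix K assume "K \<in> \<F>"
          then have "Inf K < Sup K" using KF by blast
          then show "?cl (Sup K) - ?cl (Inf K) \<le> Sup K - Inf K" using ab by (auto simp: max_def min_def)
        qed
        with len fam D have "(\<Sum>K\<in>\<F>. norm (G (Sup K) - G (Inf K))) < e"
          unfolding G_def by (meson order.strict_trans1)
        moreover have "emeasure ?N K = ennreal (norm (G (Sup K) - G (Inf K)))" if KI: "K \<in> \<F>" for K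
        proof -
          have le: "Inf K \<le> Sup K" using KF[OF KI] by simp
          have "emeasure ?N {Inf K..Sup K} = ennreal (G (Sup K) - G (Inf K))"
            using le monoD[OF monoG] contG by (intro emeasure_interval_measure_Icc) auto
          then show ?thesis using KF[OF KI] monoD[OF monoG le] by simp
        qed
        then have "(\<Sum>K\<in>\<F>. emeasure ?N K) = (\<Sum>K\<in>\<F>. ennreal (norm (G (Sup K) - G (Inf K))))"
          by (rule sum.cong[OF refl])
        then have "(\<Sum>K\<in>\<F>. emeasure ?N K) = ennreal (\<Sum>K\<in>\<F>. norm (G (Sup K) - G (Inf K)))"
          by (subst (asm) sum_ennreal) auto
        ultimately show ?thesis by (simp add: ennreal_leI)
      qed
      have \<D>s: "\<D> \<subseteq> sets ?N" using \<D>(2) by fastforce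
      have "emeasure ?N A \<le> emeasure ?N (\<Union>\<D>)"
        using \<D>(5) \<D>s \<D>(1) by (intro emeasure_mono sets.countable_Union)
      also have "\<dots> \<le> ennreal e"
        by (rule emeasure_Union_le_if_finite_sums_le[OF \<D>(1) \<D>s sum_le])
      finally show ?thesis .
    qed
    then have "emeasure ?N A \<le> 0 + ennreal e" if "e > 0" for e using that by simp
    then have "emeasure ?N A \<le> 0" by (rule ennreal_le_epsilon)
    then show ?thesis using A(1) by (intro null_setsI) auto
  qed
  show "absolutely_continuous lborel ?N"
    unfolding absolutely_continuous_def
  proof
    fix A :: "real set" assume A: "A \<in> null_sets lborel"
    have "A \<inter> cbox (- real (Suc n)) (real (Suc n)) \<in> null_sets ?N" for n
      using A by (intro bounded_null[of _ "real (Suc n)"] null_set_Int2) auto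
    then have "(\<Union>n. A \<inter> cbox (- real (Suc n)) (real (Suc n))) \<in> null_sets ?N" by blast
    moreover have "(\<Union>n. A \<inter> cbox (- real (Suc n)) (real (Suc n))) = A"
    proof -
      have "\<exists>n. x \<in> cbox (- real (Suc n)) (real (Suc n))" for x :: real
      proof -
        obtain n where "\<bar>x\<bar> \<le> real n" using real_arch_simple by blast
        then show ?thesis by (intro exI[of _ n]) auto
      qed
      then show ?thesis by blast
    qed
    ultimately show "A \<in> null_sets ?N" by simp
  qed
qed

lemma abs_continuous_mono_imp_has_integral:
  fixes F :: "real \<Rightarrow> real"
  assumes ab: "a \<le> b" and ac: "abs_continuous_on_interval a b F" and mono: "mono_on {a..b} F"
  shows "\<exists>h. h absolutely_integrable_on {a..b} \<and>
    (\<forall>t\<in>{a..b}. (h has_integral (F t - F a)) {a..t})"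
proof -
  define G where "G = (\<lambda>t. F (max a (min b t)))"
  note G = absolutely_continuous_interval_measure[OF ab ac mono, folded G_def]
  obtain f where f: "f \<in> borel_measurable lborel" and dens: "density lborel f = interval_measure G"
    using sigma_finite_measure.Radon_Nikodym[OF sigma_finite_lborel G(1)] by auto
  have nn: "(\<integral>\<^sup>+x. f x * indicator {a<..t} x \<partial>lborel) = ennreal (F t - F a)" if t: "t \<in> {a..b}" for t
  proof -
    have "(\<integral>\<^sup>+x. f x * indicator {a<..t} x \<partial>lborel) = emeasure (interval_measure G) {a<..t}"
      unfolding dens[symmetric] using f by (simp add: emeasure_density)
    also have "\<dots> = ennreal (G t - G a)"
      using t monoD[OF G(2)] G(3)
      by (intro emeasure_interval_measure_Ioc)
         (auto simp: continuous_on_eq_continuous_within intro: continuous_within_subset)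
    also have "G t - G a = F t - F a" using t ab unfolding G_def by (auto simp: max_def min_def)
    finally show ?thesis .
  qed
  have fin: "AE x in lborel. f x * indicator {a<..b} x \<noteq> \<infinity>"
    using nn[of b] ab f by (intro nn_integral_PInf_AE) auto
  define h where "h = (\<lambda>x. enn2real (f x))"
  have hint: "(h has_integral (F t - F a)) {a..t}" if t: "t \<in> {a..b}" for t
  proof -
    have ge: "F a \<le> F t" using t ab by (intro mono_onD[OF mono]) auto
    have "((\<lambda>x. h x * indicator {a<..t} x) has_integral (F t - F a)) UNIV"
    proof (rule nn_integral_has_integral)
      show "(\<lambda>x. h x * indicator {a<..t} x) \<in> borel_measurable borel"
        using f unfolding h_def by auto
      have "(\<integral>\<^sup>+x. ennreal (h x * indicator {a<..t} x) \<partial>lborel) = (\<integral>\<^sup>+x. f x * indicator {a<..t} x \<partial>lborel)"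
      proof (rule nn_integral_cong_AE, use fin in eventually_elim)
        fix x assume "f x * indicator {a<..b} x \<noteq> \<infinity>"
        then show "ennreal (h x * indicator {a<..t} x) = f x * indicator {a<..t} x"
          using t unfolding h_def by (auto simp: indicator_def less_top split: if_splits)
      qed
      then show "(\<integral>\<^sup>+x. ennreal (h x * indicator {a<..t} x) \<partial>lborel) = ennreal (F t - F a)"
        using nn[OF t] by simp
    qed (use ge in \<open>auto simp: h_def\<close>)
    then have "((\<lambda>x. if x \<in> {a<..t} then h x else 0) has_integral (F t - F a)) UNIV"
      by (rule has_integral_cong[THEN iffD1, rotated]) auto
    then have "(h has_integral (F t - F a)) {a<..t}" by (simp only: has_integral_restrict_UNIV)
    moreover have "negligible {x \<in> {a<..t} - {a..t}. h x \<noteq> 0}" "negligible {x \<in> {a..t} - {a<..t}. h x \<noteq> 0}"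
      by (auto intro: negligible_subset[of "{a}"])
    ultimately show ?thesis using has_integral_spike_set_eq by blast
  qed
  have "h absolutely_integrable_on {a..b}"
    using hint[of b] ab by (intro nonnegative_absolutely_integrable_1) (auto simp: h_def)
  then show ?thesis using hint by blast
qed

section \<open>The fundamental theorem of calculus for absolutely continuous functions\<close>

lemma abs_continuous_on_interval_diff:
  fixes f g :: "real \<Rightarrow> real"
  assumes f: "abs_continuous_on_interval a b f" and g: "abs_continuous_on_interval a b g"
  shows "abs_continuous_on_interval a b (\<lambda>t. f t - g t)"
  unfolding abs_continuous_on_interval_def
proof (intro allI impI)
  fix e :: real assume e: "e > 0"
  obtain d1 where d1: "d1 > 0" and D1: "\<forall>(I :: nat set) l u. interval_family a b I l u \<longrightarrow>
      (\<Sum>i\<in>I. u i - l i) < d1 \<longrightarrow> (\<Sum>i\<in>I. norm (f (u i) - f (l i))) < e/2"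
    using abs_continuous_on_intervalD[OF f half_gt_zero[OF e]] by blast
  obtain d2 where d2: "d2 > 0" and D2: "\<forall>(I :: nat set) l u. interval_family a b I l u \<longrightarrow>
      (\<Sum>i\<in>I. u i - l i) < d2 \<longrightarrow> (\<Sum>i\<in>I. norm (g (u i) - g (l i))) < e/2"
    using abs_continuous_on_intervalD[OF g half_gt_zero[OF e]] by blast
  have "(\<Sum>i<n. norm (f (u i) - g (u i) - (f (l i) - g (l i)))) < e"
    if "\<forall>i<n. a \<le> l i \<and> l i \<le> u i \<and> u i \<le> b" "disjoint_family_on (\<lambda>i. {l i<..<u i}) {..<n}"
      and len: "(\<Sum>i<n. u i - l i) < min d1 d2" for n :: nat and l u
  proof -
    have fam: "interval_family a b {..<n} l u" using that unfolding interval_family_def by auto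
    have "(\<Sum>i<n. norm (f (u i) - g (u i) - (f (l i) - g (l i))))
        \<le> (\<Sum>i<n. norm (f (u i) - f (l i)) + norm (g (u i) - g (l i)))"
      by (rule sum_mono) simp
    also have "\<dots> = (\<Sum>i<n. norm (f (u i) - f (l i))) + (\<Sum>i<n. norm (g (u i) - g (l i)))"
      by (rule sum.distrib)
    also have "\<dots> < e/2 + e/2"
      using D1 D2 fam len by (intro add_strict_mono) auto
    finally show ?thesis by simp
  qed
  then show "\<exists>d>0. \<forall>(n::nat) l u. (\<forall>i<n. a \<le> l i \<and> l i \<le> u i \<and> u i \<le> b) \<longrightarrow>
      disjoint_family_on (\<lambda>i. {l i<..<u i}) {..<n} \<longrightarrow> (\<Sum>i<n. u i - l i) < d \<longrightarrow>
      (\<Sum>i<n. norm (f (u i) - g (u i) - (f (l i) - g (l i)))) < e"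
    using d1 d2 by (intro exI[of _ "min d1 d2"]) simp
qed

lemma abs_continuous_has_integral:
  fixes f :: "real \<Rightarrow> real"
  assumes ab: "a \<le> b" and ac: "abs_continuous_on_interval a b f"
  shows "\<exists>h. h absolutely_integrable_on {a..b} \<and>
    (\<forall>t\<in>{a..b}. (h has_integral (f t - f a)) {a..t})"
proof -
  let ?P = "positive_variation f a"
  let ?N = "\<lambda>t. ?P t - f t"
  note acP = abs_continuous_positive_variation[OF ac]
  have "mono_on {a..b} ?P" using positive_variation_mono[OF ac] by (intro mono_onI) auto
  from abs_continuous_mono_imp_has_integral[OF ab acP this]
  obtain hP where hP: "hP absolutely_integrable_on {a..b}"
    "\<And>t. t \<in> {a..b} \<Longrightarrow> (hP has_integral (?P t - ?P a)) {a..t}" by blast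
  have "mono_on {a..b} ?N"
  proof (rule mono_onI)
    fix s t assume "s \<in> {a..b}" "t \<in> {a..b}" "s \<le> t"
    then show "?N s \<le> ?N t" using positive_variation_increment_ge[OF ac, of s t] by simp
  qed
  from abs_continuous_mono_imp_has_integral[OF ab abs_continuous_on_interval_diff[OF acP ac] this]
  obtain hN where hN: "hN absolutely_integrable_on {a..b}"
    "\<And>t. t \<in> {a..b} \<Longrightarrow> (hN has_integral (?N t - ?N a)) {a..t}" by blast
  show ?thesis
  proof (intro exI conjI ballI)
    show "(\<lambda>t. hP t - hN t) absolutely_integrable_on {a..b}"
      using hP(1) hN(1) by (rule set_integral_diff)
    show "((\<lambda>t. hP t - hN t) has_integral (f t - f a)) {a..t}" if "t \<in> {a..b}" for t
      using has_integral_diff[OF hP(2)[OF that] hN(2)[OF that]] by simp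
  qed
qed

text \<open>
  Lebesgue's differentiation theorem in the form \<open>integrable_ccontinuous_explicit\<close> speaks of
  averages over cubes with a given lower corner, that is, of right derivatives.  Reflecting the integrand
  gives left derivatives.
\<close>

lemma AE_has_real_derivative_indefinite_integral:
  fixes h F :: "real \<Rightarrow> real"
  assumes int: "h integrable_on {a..b}"
    and F: "\<And>t. t \<in> {a..b} \<Longrightarrow> (h has_integral (F t - F a)) {a..t}"
  obtains N where "negligible N" "\<And>t. t \<in> {a..b} - N \<Longrightarrow> (F has_real_derivative h t) (at t)"
proof -
  define k where "k = (\<lambda>x. if x \<in> {a..b} then h x else 0)"
  have "k integrable_on UNIV" unfolding k_def using int by (simp only: integrable_restrict_UNIV)
  then have kint: "k integrable_on cbox c d" for c d
    by (rule integrable_on_subcbox) simp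
  have krint: "(\<lambda>x. k (- x)) integrable_on cbox c d" for c d :: real
    using kint[of "-d" "-c"] Henstock_Kurzweil_Integration.integrable_reflect_real[where f = k and b = "-c" and a = "-d"] by auto
  obtain N1 where N1: "negligible N1" "\<And>x e. \<lbrakk>x \<notin> N1; 0 < e\<rbrakk> \<Longrightarrow> \<exists>d>0. \<forall>r. 0 < r \<and> r < d \<longrightarrow>
      norm (integral (cbox x (x + r *\<^sub>R One)) k /\<^sub>R r ^ DIM(real) - k x) < e"
    using integrable_ccontinuous_explicit[OF kint] by metis
  obtain N2 where N2: "negligible N2" "\<And>x e. \<lbrakk>x \<notin> N2; 0 < e\<rbrakk> \<Longrightarrow> \<exists>d>0. \<forall>r. 0 < r \<and> r < d \<longrightarrow>
      norm (integral (cbox x (x + r *\<^sub>R One)) (\<lambda>x. k (- x)) /\<^sub>R r ^ DIM(real) - k (- x)) < e"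
    using integrable_ccontinuous_explicit[OF krint] by metis
  \<comment> \<open>At the end points the integral is only known on one side.\<close>
  define N where "N = N1 \<union> uminus ` N2 \<union> {a, b}"
  have "negligible N"
    unfolding N_def using N1(1) negligible_differentiable_image_negligible[OF order_refl N2(1)]
    by (auto intro!: derivative_intros)
  have incr: "integral {s..t} k = F t - F s" if "a \<le> s" "s \<le> t" "t \<le> b" for s t
  proof -
    have "h integrable_on {a..t}" using F[of t] that by auto
    then have "integral {a..s} h + integral {s..t} h = integral {a..t} h"
      using that by (intro Henstock_Kurzweil_Integration.integral_combine) auto
    moreover have "integral {a..s} h = F s - F a" "integral {a..t} h = F t - F a"
      using F[of s] F[of t] that by (auto intro: integral_unique)
    moreover have "integral {s..t} k = integral {s..t} h"
      using that unfolding k_def by (intro integral_cong) auto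
    ultimately show ?thesis by simp
  qed
  have "(F has_real_derivative h t) (at t)" if t: "t \<in> {a..b} - N" for t
    unfolding DERIV_def LIM_eq
  proof (intro allI impI)
    fix e :: real assume e: "e > 0"
    have tab: "a < t" "t < b" and tN: "t \<notin> N1" "- t \<notin> N2"
      using t unfolding N_def by (auto simp: image_iff)
    have kt: "k t = h t" using tab unfolding k_def by simp
    obtain d1 where d1: "d1 > 0" "\<And>r. 0 < r \<Longrightarrow> r < d1 \<Longrightarrow> norm (integral {t..t + r} k / r - k t) < e"
      using N1(2)[OF tN(1) e] by (auto simp: divide_inverse mult.commute)
    obtain d2 where d2: "d2 > 0"
      "\<And>r. 0 < r \<Longrightarrow> r < d2 \<Longrightarrow> norm (integral {- t..- t + r} (\<lambda>x. k (- x)) / r - k t) < e"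
      using N2(2)[OF tN(2) e] by (auto simp: divide_inverse mult.commute)
    define d where "d = min (min d1 d2) (min (t - a) (b - t))"
    have "norm ((F (t + r) - F t) / r - h t) < e" if r: "r \<noteq> 0" "norm r < d" for r
    proof (cases "r > 0")
      case True
      then show ?thesis
        using d1(2)[of r] incr[of t "t + r"] r tab kt unfolding d_def by auto
    next
      case False
      then have r': "0 < - r" "- r < d2" "a \<le> t + r" "t + r \<le> t" using r unfolding d_def by auto
      have "integral {- t..- t + - r} (\<lambda>x. k (- x)) = integral {t + r..t} k"
        using Henstock_Kurzweil_Integration.integral_reflect_real[where f = k and b = t and a = "t + r"] by simp
      also have "\<dots> = F t - F (t + r)" using r' tab by (intro incr) auto
      finally have "norm ((F t - F (t + r)) / (- r) - k t) < e" using d2(2)[OF r'(1,2)] by simp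
      moreover have "(F t - F (t + r)) / (- r) = (F (t + r) - F t) / r"
        using r by (simp add: field_simps)
      ultimately show ?thesis using kt by simp
    qed
    moreover have "d > 0" using d1(1) d2(1) tab unfolding d_def by simp
    ultimately show "\<exists>s>0. \<forall>r. r \<noteq> 0 \<and> norm (r - 0) < s \<longrightarrow> norm ((F (t + r) - F t) / r - h t) < e"
      by auto
  qed
  then show thesis using that \<open>negligible N\<close> by blast
qed

text \<open>
  The exceptional set absorbs the end points, so the derivative can be taken two-sided.
\<close>

theorem abs_continuous_fundamental_theorem:
  fixes f :: "real \<Rightarrow> real"
  assumes "a \<le> b" and "abs_continuous_on_interval a b f"
  shows "\<exists>h N. h absolutely_integrable_on {a..b} \<and> (h has_integral (f b - f a)) {a..b} \<and>
    negligible N \<and> (\<forall>t \<in> {a..b} - N. (f has_real_derivative h t) (at t))"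
proof -
  obtain h where h: "h absolutely_integrable_on {a..b}"
    "\<And>t. t \<in> {a..b} \<Longrightarrow> (h has_integral (f t - f a)) {a..t}"
    using abs_continuous_has_integral[OF assms] by blast
  have "h integrable_on {a..b}" using h(1) set_lebesgue_integral_eq_integral(1) by blast
  from AE_has_real_derivative_indefinite_integral[OF this h(2)]
  obtain N where "negligible N" "\<And>t. t \<in> {a..b} - N \<Longrightarrow> (f has_real_derivative h t) (at t)" by blast
  moreover have "(h has_integral (f b - f a)) {a..b}" using h(2) assms(1) by simp
  ultimately show ?thesis using h(1) by blast
qed

section \<open>Derivatives of the distance to a set of reals\<close>

text \<open>
  A set-valued derivative of the distance to \<open>A\<close>.  Off \<open>A\<close> it consists of the directions from a nearest
  point to \<open>a\<close>; on \<open>A\<close> it is the whole interval \<open>{-1..1}\<close>.  The equation for \<open>s\<close> covers both cases, since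
  it is void for \<open>p = a\<close>.
\<close>

definition distance_slopes :: "real set \<Rightarrow> real \<Rightarrow> real set" where
  "distance_slopes A a = {s. \<bar>s\<bar> \<le> 1 \<and> (\<exists>p\<in>A. \<bar>a - p\<bar> = infdist a A \<and> s * \<bar>a - p\<bar> = a - p)}"

text \<open>
  The graph is a projection, along the compact set \<open>A\<close> of nearest points, of a set defined by equations between
  continuous functions.
\<close>

lemma closed_distance_slopes:
  assumes "compact A"
  shows "closed {(a, s). s \<in> distance_slopes A a}"
proof -
  have "closed {(p::real, a, s). \<bar>s\<bar> \<le> 1 \<and> \<bar>a - p\<bar> = infdist a A \<and> s * \<bar>a - p\<bar> = a - p}"
    unfolding split_def by (intro closed_Collect_conj closed_Collect_eq closed_Collect_le continuous_intros)
  from closed_compact_projection[OF assms this] show ?thesis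
    unfolding distance_slopes_def by (rule back_subst[where P = closed]) auto
qed

lemma distance_slopes_nonempty:
  assumes "closed A" "A \<noteq> {}"
  shows "distance_slopes A a \<noteq> {}"
proof -
  obtain p where "p \<in> A" "infdist a A = dist a p" using infdist_attains_inf[OF assms] by blast
  then have "sgn (a - p) \<in> distance_slopes A a"
    unfolding distance_slopes_def by (auto simp: dist_real_def sgn_mult_abs abs_sgn_eq)
  then show ?thesis by blast
qed

text \<open>
  If \<open>p\<close> is nearest to \<open>u t\<close>, then \<open>\<lambda>r. \<bar>u r - p\<bar> - infdist (u r) A\<close> is nonnegative and vanishes at \<open>t\<close>, so its
  derivative there is zero.  Where \<open>u t \<in> A\<close>, the distance itself has a minimum at \<open>t\<close>.
\<close>

lemma distance_slopes_chain_rule: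
  fixes u :: "real \<Rightarrow> real"
  assumes du: "(u has_real_derivative u') (at t)"
    and dh: "((\<lambda>r. infdist (u r) A) has_real_derivative h') (at t)"
    and s: "s \<in> distance_slopes A (u t)" and crit: "u t \<in> A \<Longrightarrow> u' = 0"
  shows "h' = s * u'"
proof (cases "u t \<in> A")
  case True
  have "h' = 0"
    using True by (intro DERIV_local_min[OF dh, of 1]) (auto simp: infdist_nonneg)
  then show ?thesis using crit[OF True] by simp
next
  case False
  obtain p where p: "p \<in> A" "\<bar>u t - p\<bar> = infdist (u t) A" "s * \<bar>u t - p\<bar> = u t - p"
    using s unfolding distance_slopes_def by auto
  have ne: "u t \<noteq> p" using False p(1) by auto
  then have s_eq: "s = sgn (u t - p)"
    using p(3) sgn_mult_abs[of "u t - p"] by (metis abs_eq_0 mult_right_cancel right_minus_eq)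
  have "((\<lambda>r. \<bar>u r - p\<bar>) has_real_derivative sgn (u t - p) * (u' - 0)) (at t)"
  proof (rule DERIV_chain'[where g = abs])
    show "((\<lambda>r. u r - p) has_real_derivative u' - 0) (at t)"
      by (intro DERIV_diff du DERIV_const)
    show "(abs has_real_derivative sgn (u t - p)) (at (u t - p))"
      using GDERIV_norm[of "u t - p"] ne by (simp add: real_norm_def[abs_def])
  qed
  then have "((\<lambda>r. \<bar>u r - p\<bar> - infdist (u r) A) has_real_derivative sgn (u t - p) * (u' - 0) - h') (at t)"
    by (intro DERIV_diff dh)
  then have "sgn (u t - p) * (u' - 0) - h' = 0"
  proof (rule DERIV_local_min[where d = 1])
    have "infdist (u r) A \<le> \<bar>u r - p\<bar>" for r using infdist_le[OF p(1)] by (simp add: dist_real_def)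
    then show "\<forall>r. \<bar>t - r\<bar> < 1 \<longrightarrow> \<bar>u t - p\<bar> - infdist (u t) A \<le> \<bar>u r - p\<bar> - infdist (u r) A"
      using p(2) by simp
  qed simp
  then show ?thesis using s_eq by simp
qed

text \<open>
  A preimage of a null set under a map with invertible derivatives is null.
\<close>

lemma negligible_nonzero_derivative_preimage:
  fixes u u' :: "real \<Rightarrow> real"
  assumes "negligible A" and "\<And>t. t \<in> S \<Longrightarrow> (u has_real_derivative u' t) (at t)"
  shows "negligible {t \<in> S. u t \<in> A \<and> u' t \<noteq> 0}"
proof -
  have "negligible {t \<in> {t \<in> S. u' t \<noteq> 0}. u t \<in> A}"
  proof (rule negligible_differentiable_vimage[OF assms(1), where f' = "\<lambda>t. (*) (u' t)"])
    fix t assume t: "t \<in> {t \<in> S. u' t \<noteq> 0}"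
    then show "inj ((*) (u' t))" by (auto intro: injI)
    show "(u has_derivative (*) (u' t)) (at t within {t \<in> S. u' t \<noteq> 0})"
      using assms(2)[of t] t unfolding has_field_derivative_def by (auto intro: has_derivative_at_withinI)
  qed
  then show ?thesis by (rule negligible_subset) auto
qed

text \<open>
  In \<open>{a<..<a + e}\<close> there is a point \<open>m\<close> outside of \<open>A\<close>.  Let \<open>p\<close> be the last point of \<open>A\<close> before \<open>m\<close>.  On the
  left half of \<open>{p..m}\<close> the nearest point is \<open>p\<close>, so the distance increases with slope \<open>1\<close>.
\<close>

lemma exists_derivative_one_infdist:
  fixes A :: "real set"
  assumes A: "closed A" "negligible A" and a: "a \<in> A" and e: "e > 0"
  obtains c where "\<bar>c - a\<bar> < e" "((\<lambda>x. infdist x A) has_real_derivative 1) (at c)"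
proof -
  have "\<not> {a<..<a + e} \<subseteq> A"
    using e negligible_subset[OF A(2)] open_not_negligible[of "{a<..<a+e}"] by auto
  then obtain m where "m \<in> {a<..<a + e}" "m \<notin> A" by blast
  then have m: "a < m" "m < a + e" "m \<notin> A" by auto
  define p where "p = Sup (A \<inter> {a..m})"
  have ne: "A \<inter> {a..m} \<noteq> {}" using a m by auto
  have pA: "p \<in> A \<inter> {a..m}" unfolding p_def
    using ne A(1) by (intro closed_contains_Sup closed_Int) (auto intro: bdd_aboveI[of _ m])
  have pm: "p < m" using pA m(3) by (cases "p = m") auto
  have gap: "x \<notin> A" if "p < x" "x \<le> m" for x
  proof
    assume "x \<in> A"
    then have "x \<le> p" unfolding p_def using that pA by (intro cSup_upper) (auto intro: bdd_aboveI[of _ m])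
    then show False using that by simp
  qed
  have dist_eq: "infdist x A = x - p" if x: "p < x" "x < (p + m) / 2" for x
  proof (rule antisym)
    show "infdist x A \<le> x - p" using infdist_le[of p A x] pA x by (simp add: dist_real_def)
    obtain q where q: "q \<in> A" "infdist x A = dist x q" using infdist_attains_inf[OF A(1)] a by blast
    show "x - p \<le> infdist x A"
    proof (cases "q \<le> p")
      case False
      then have "q > m" using gap[of q] q(1) by (meson not_le)
      then show ?thesis using q(2) x by (simp add: dist_real_def)
    qed (use q x in \<open>simp add: dist_real_def\<close>)
  qed
  \<comment> \<open>The middle of the left half, so that the formula for the distance holds near \<open>c\<close>.\<close>
  define c where "c = (3 * p + m) / 4"
  have c: "p < c" "c < (p + m) / 2" using pm unfolding c_def by auto
  have "((\<lambda>x. x - p) has_real_derivative 1) (at c)" by (auto intro!: derivative_eq_intros)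
  then have "((\<lambda>x. infdist x A) has_real_derivative 1) (at c)"
    by (rule has_field_derivative_transform_within_open[where S = "{p<..<(p + m) / 2}"])
       (use c dist_eq in auto)
  moreover have "\<bar>c - a\<bar> < e" using c pA m by (auto simp: abs_if)
  ultimately show thesis by (rule that[rotated])
qed

lemma abs_continuous_on_interval_lipschitz_compose:
  assumes f: "abs_continuous_on_interval a b f" and lip: "C-lipschitz_on UNIV g"
  shows "abs_continuous_on_interval a b (\<lambda>t. g (f t))"
  unfolding abs_continuous_on_interval_def
proof (intro allI impI)
  fix e :: real assume e: "e > 0"
  have C: "C \<ge> 0" by (rule lipschitz_on_nonneg[OF lip])
  have "e / (C + 1) > 0" using e C by simp
  from abs_continuous_on_intervalD[OF f this, where 'i = nat]
  obtain d where d: "d > 0" and D: "\<forall>(I :: nat set) l u. interval_family a b I l u \<longrightarrow>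
      (\<Sum>i\<in>I. u i - l i) < d \<longrightarrow> (\<Sum>i\<in>I. norm (f (u i) - f (l i))) < e / (C + 1)" by blast
  have "(\<Sum>i<n. norm (g (f (u i)) - g (f (l i)))) < e"
    if "\<forall>i<n. a \<le> l i \<and> l i \<le> u i \<and> u i \<le> b" "disjoint_family_on (\<lambda>i. {l i<..<u i}) {..<n}"
      and len: "(\<Sum>i<n. u i - l i) < d" for n :: nat and l u
  proof -
    have "interval_family a b {..<n} l u" using that unfolding interval_family_def by auto
    then have less: "(\<Sum>i<n. norm (f (u i) - f (l i))) < e / (C + 1)" using D len by blast
    have "(\<Sum>i<n. norm (g (f (u i)) - g (f (l i)))) \<le> (\<Sum>i<n. C * norm (f (u i) - f (l i)))"
      using lipschitz_onD[OF lip] by (intro sum_mono) (auto simp: dist_norm)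
    also have "\<dots> = C * (\<Sum>i<n. norm (f (u i) - f (l i)))" by (simp add: sum_distrib_left)
    also have "\<dots> \<le> (C + 1) * (\<Sum>i<n. norm (f (u i) - f (l i)))"
      using C by (intro mult_right_mono sum_nonneg) auto
    also have "\<dots> < (C + 1) * (e / (C + 1))" using less C by (intro mult_strict_left_mono) auto
    also have "\<dots> = e" using C by simp
    finally show ?thesis .
  qed
  then show "\<exists>d>0. \<forall>(n::nat) l u. (\<forall>i<n. a \<le> l i \<and> l i \<le> u i \<and> u i \<le> b) \<longrightarrow>
      disjoint_family_on (\<lambda>i. {l i<..<u i}) {..<n} \<longrightarrow> (\<Sum>i<n. u i - l i) < d \<longrightarrow>
      (\<Sum>i<n. norm (g (f (u i)) - g (f (l i)))) < e"
    using d by (intro exI[of _ d]) simp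
qed

section \<open>Expansions in base 4\<close>

definition expansion4 :: "(nat \<Rightarrow> nat) \<Rightarrow> real \<Rightarrow> bool" where
  "expansion4 q x \<longleftrightarrow> (\<forall>k. q k \<le> 3) \<and> (\<lambda>k. real (q k) / 4 ^ Suc k) sums x"

text \<open>
  Digits produced by a map of the form \<open>z \<mapsto> 4 * z - digit\<close> expand the starting point if the orbit stays bounded.
\<close>

lemma sums_digits_of_orbit:
  fixes z :: "nat \<Rightarrow> real" and q :: "nat \<Rightarrow> nat"
  assumes step: "\<And>k. 4 * z k = real (q k) + z (Suc k)" and bound: "\<And>k. \<bar>z k\<bar> \<le> 1"
  shows "(\<lambda>k. real (q k) / 4 ^ Suc k) sums z 0"
proof -
  have partial: "(\<Sum>k<n. real (q k) / 4 ^ Suc k) = z 0 - z n / 4 ^ n" for n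
  proof (induction n)
    case (Suc n)
    then show ?case using step[of n] by (simp add: field_simps)
  qed simp
  have "(\<lambda>n. (1 / 4 :: real) ^ n) \<longlonglongrightarrow> 0" by (rule LIMSEQ_power_zero) simp
  then have "(\<lambda>n. z n / 4 ^ n) \<longlonglongrightarrow> 0"
  proof (rule Lim_null_comparison[rotated])
    show "\<forall>\<^sub>F n in sequentially. norm (z n / 4 ^ n) \<le> (1 / 4) ^ n"
      using bound by (auto simp: power_divide divide_right_mono intro!: always_eventually)
  qed
  then have "(\<lambda>n. z 0 - z n / 4 ^ n) \<longlonglongrightarrow> z 0 - 0" by (intro tendsto_intros)
  then show ?thesis unfolding sums_def partial by simp
qed

lemma exists_expansion4:
  assumes "x \<in> {0..1}"
  obtains q where "expansion4 q x"
proof -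
  \<comment> \<open>The minimum only matters for \<open>z = 1\<close>, which has the expansion \<open>0.333\<dots>\<close>.\<close>
  define digit where "digit z = min 3 (nat \<lfloor>4 * z\<rfloor>)" for z :: real
  define T where "T z = 4 * z - real (digit z)" for z
  define z where "z k = (T ^^ k) x" for k
  have "T w \<in> {0..1}" if "w \<in> {0..1}" for w
  proof (cases "4 * w < 4")
    case True
    then have "\<lfloor>4 * w\<rfloor> \<le> 3" "0 \<le> \<lfloor>4 * w\<rfloor>" using that by (auto simp: floor_le_iff)
    then have "digit w = nat \<lfloor>4 * w\<rfloor>" unfolding digit_def by (intro min_absorb2) linarith
    then have "real (digit w) = real_of_int \<lfloor>4 * w\<rfloor>" using \<open>0 \<le> \<lfloor>4 * w\<rfloor>\<close> by simp
    then show ?thesis unfolding T_def by (simp; linarith)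
  next
    case False
    then have "w = 1" using that by simp
    then show ?thesis unfolding T_def digit_def by simp
  qed
  then have range: "z k \<in> {0..1}" for k
    by (induction k) (use assms in \<open>auto simp: z_def\<close>)
  have "(\<lambda>k. real (digit (z k)) / 4 ^ Suc k) sums z 0"
  proof (rule sums_digits_of_orbit)
    show "4 * z k = real (digit (z k)) + z (Suc k)" for k by (simp add: z_def T_def)
    show "\<bar>z k\<bar> \<le> 1" for k using range[of k] by simp
  qed
  then show thesis by (intro that[of "\<lambda>k. digit (z k)"]) (simp add: expansion4_def digit_def z_def)
qed

text \<open>
  The carry \<open>0.1000\<dots> = 0.0333\<dots>\<close> in base 4, at position \<open>k\<close>.
\<close>

lemma sums_carry:
  "(\<lambda>j. if j < k then 0 else if j = k then - 1 / 4 ^ Suc k else 3 / 4 ^ Suc j) sums (0 :: real)"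
proof -
  let ?b = "\<lambda>j. if j < k then 0 else if j = k then - 1 / 4 ^ Suc k else (3::real) / 4 ^ Suc j"
  have partial: "(\<Sum>j<n. ?b j) = (if n \<le> k then 0 else - ((1 / 4) ^ n))" for n
  proof (induction n)
    case (Suc n)
    consider "n < k" | "n = k" | "k < n" by linarith
    then show ?case
    proof cases
      case 3
      then show ?thesis using Suc by (simp add: power_divide field_simps)
    qed (use Suc in \<open>auto simp: power_divide\<close>)
  qed simp
  have "(\<lambda>n. - ((1 / 4 :: real) ^ n)) \<longlonglongrightarrow> - 0" by (intro tendsto_minus LIMSEQ_power_zero) simp
  moreover have "\<forall>\<^sub>F n in sequentially. - ((1 / 4 :: real) ^ n) = (\<Sum>j<n. ?b j)"
    unfolding partial using eventually_gt_at_top[of k] by eventually_elim simp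
  ultimately show ?thesis unfolding sums_def by (simp add: tendsto_cong)
qed

text \<open>
  At the first difference \<open>r\<close> is ahead by at least one unit, and the later digits can make up for at most one
  unit.  Adding the carry to the difference of the expansions thus leaves a series of nonnegative terms with
  sum zero, and all terms vanish.
\<close>

lemma expansion4_first_difference:
  assumes q: "expansion4 q x" and r: "expansion4 r x"
    and eq: "\<And>j. j < k \<Longrightarrow> q j = r j" and less: "q k < r k" and j: "k < j"
  shows "q j = 3 \<and> r j = 0"
proof -
  let ?b = "\<lambda>j. if j < k then 0 else if j = k then - 1 / 4 ^ Suc k else (3::real) / 4 ^ Suc j"
  define c where "c j = real (r j) / 4 ^ Suc j - real (q j) / 4 ^ Suc j + ?b j" for j
  have q3: "real (q j) \<le> 3" for j using q unfolding expansion4_def by (metis of_nat_le_iff of_nat_numeral)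
  have "c sums (x - x + 0)" unfolding c_def
    using q r unfolding expansion4_def by (intro sums_add sums_diff sums_carry) auto
  then have c0: "c sums 0" by simp
  have cj: "c j = (real (r j) + (3 - real (q j))) / 4 ^ Suc j" if "k < j" for j
    using that unfolding c_def by (simp add: field_simps)
  have "c j \<ge> 0" for j
  proof -
    consider "j < k" | "j = k" | "k < j" by linarith
    then show ?thesis
    proof cases
      case 2
      have "real (q k) + 1 \<le> real (r k)" using less by linarith
      moreover have "c k = (real (r k) - real (q k) - 1) / 4 ^ Suc k"
        unfolding c_def by (simp add: diff_divide_distrib)
      ultimately show ?thesis unfolding 2 by simp
    next
      case 3
      then show ?thesis using cj[OF 3] q3[of j] by simp
    qed (use eq in \<open>simp add: c_def\<close>)
  qed
  moreover have "summable c" "suminf c = 0" using c0 by (auto simp: sums_iff)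
  ultimately have "c j = 0" using suminf_eq_zero_iff by blast
  then have "real (r j) + (3 - real (q j)) = 0" using cj[OF j] by simp
  then have "real (r j) = 0 \<and> real (q j) = 3" using q3[of j] by linarith
  then show ?thesis by simp
qed

lemma expansion4_tails:
  assumes q: "expansion4 q x" and r: "expansion4 r x" and ne: "q \<noteq> r"
  obtains k where "(\<forall>j>k. q j = 3 \<and> r j = 0) \<or> (\<forall>j>k. q j = 0 \<and> r j = 3)"
proof -
  define k where "k = (LEAST k. q k \<noteq> r k)"
  have "\<exists>k. q k \<noteq> r k" using ne by auto
  then have k: "q k \<noteq> r k" unfolding k_def by (rule LeastI_ex)
  have eq: "q j = r j" if "j < k" for j using not_less_Least that unfolding k_def by blast
  show thesis
  proof (rule that[of k], cases "q k < r k")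
    case True
    then show "(\<forall>j>k. q j = 3 \<and> r j = 0) \<or> (\<forall>j>k. q j = 0 \<and> r j = 3)"
      using expansion4_first_difference[OF q r eq] by blast
  next
    case False
    then have "r k < q k" using k by simp
    then show "(\<forall>j>k. q j = 3 \<and> r j = 0) \<or> (\<forall>j>k. q j = 0 \<and> r j = 3)"
      using expansion4_first_difference[OF r q eq[symmetric]] by blast
  qed
qed

text \<open>
  Of any two expansions one ends in zeros and the other in threes, and three expansions cannot differ
  pairwise in this way.
\<close>

lemma expansion4_at_most_two:
  assumes "expansion4 q x" "expansion4 r x" "expansion4 s x" "q \<noteq> r"
  shows "s = q \<or> s = r"
proof (rule ccontr)
  assume "\<not> (s = q \<or> s = r)"
  then have ne: "s \<noteq> q" "s \<noteq> r" by auto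
  obtain k1 where 1: "(\<forall>j>k1. q j = 3 \<and> r j = 0) \<or> (\<forall>j>k1. q j = 0 \<and> r j = 3)"
    using expansion4_tails[OF assms(1,2,4)] .
  obtain k2 where 2: "(\<forall>j>k2. s j = 3 \<and> q j = 0) \<or> (\<forall>j>k2. s j = 0 \<and> q j = 3)"
    using expansion4_tails[OF assms(3,1) ne(1)] .
  obtain k3 where 3: "(\<forall>j>k3. s j = 3 \<and> r j = 0) \<or> (\<forall>j>k3. s j = 0 \<and> r j = 3)"
    using expansion4_tails[OF assms(3,2) ne(2)] .
  define j where "j = Suc (k1 + k2 + k3)"
  have "k1 < j" "k2 < j" "k3 < j" unfolding j_def by auto
  with 1 2 3 have "(q j = 3 \<and> r j = 0) \<or> (q j = 0 \<and> r j = 3)"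
    "(s j = 3 \<and> q j = 0) \<or> (s j = 0 \<and> q j = 3)" "(s j = 3 \<and> r j = 0) \<or> (s j = 0 \<and> r j = 3)"
    by blast+
  then show False by auto
qed

lemma countable_two_expansions: "countable {x. \<exists>q r. expansion4 q x \<and> expansion4 r x \<and> q \<noteq> r}"
proof (rule countable_subset)
  let ?f = "\<lambda>(m::nat, n::nat). real m / 4 ^ n"
  show "countable (range ?f)" by simp
  have finite_exp: "x \<in> range ?f" if q: "expansion4 q x" and zero: "\<And>j. k < j \<Longrightarrow> q j = 0" for q x k
  proof -
    have "(\<lambda>j. real (q j) / 4 ^ Suc j) sums (\<Sum>j\<le>k. real (q j) / 4 ^ Suc j)"
      using zero by (intro sums_finite) auto
    then have "x = (\<Sum>j\<le>k. real (q j) / 4 ^ Suc j)"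
      using q sums_unique2 unfolding expansion4_def by blast
    \<comment> \<open>A common denominator shows that \<open>x\<close> is one of countably many fractions.\<close>
    also have "\<dots> = (\<Sum>j\<le>k. real (q j * 4 ^ (k - j)) / 4 ^ Suc k)"
    proof (rule sum.cong[OF refl])
      fix j assume "j \<in> {..k}"
      then have "(4::real) ^ Suc k = 4 ^ (k - j) * 4 ^ Suc j" by (simp flip: power_add)
      then show "real (q j) / 4 ^ Suc j = real (q j * 4 ^ (k - j)) / 4 ^ Suc k" by simp
    qed
    also have "\<dots> = real (\<Sum>j\<le>k. q j * 4 ^ (k - j)) / 4 ^ Suc k"
      by (simp add: sum_divide_distrib)
    finally have "x = ?f (\<Sum>j\<le>k. q j * 4 ^ (k - j), Suc k)" by simp
    then show ?thesis by (rule range_eqI)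
  qed
  show "{x. \<exists>q r. expansion4 q x \<and> expansion4 r x \<and> q \<noteq> r} \<subseteq> range ?f"
  proof clarify
    fix x q r assume "expansion4 q x" "expansion4 r x" "q \<noteq> r"
    then obtain k where "(\<forall>j>k. q j = 3 \<and> r j = 0) \<or> (\<forall>j>k. q j = 0 \<and> r j = 3)"
      by (rule expansion4_tails)
    then show "x \<in> range ?f"
      using finite_exp[OF \<open>expansion4 q x\<close>, of k] finite_exp[OF \<open>expansion4 r x\<close>, of k] by blast
  qed
qed

lemma two_expansions_inverse_power:
  "\<exists>q r. expansion4 q (1 / 4 ^ Suc n) \<and> expansion4 r (1 / 4 ^ Suc n) \<and> q \<noteq> r"
proof (intro exI conjI)
  let ?q = "\<lambda>k::nat. if k = n then 1 else 0 :: nat" and ?r = "\<lambda>k::nat. if k \<le> n then 0 else 3 :: nat"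
  have single: "(\<lambda>k. real (?q k) / 4 ^ Suc k) sums (1 / 4 ^ Suc n)"
    using sums_single[of n "\<lambda>k. 1 / 4 ^ Suc k :: real"] by (rule sums_cong[THEN iffD1, rotated]) auto
  then show "expansion4 ?q (1 / 4 ^ Suc n)" unfolding expansion4_def by simp
  have "(\<lambda>k. real (?r k) / 4 ^ Suc k) sums (1 / 4 ^ Suc n + 0)"
    using sums_add[OF single sums_carry[of n]] by (rule sums_cong[THEN iffD1, rotated]) auto
  then show "expansion4 ?r (1 / 4 ^ Suc n)" unfolding expansion4_def by simp
  show "?q \<noteq> ?r" by (auto simp: fun_eq_iff)
qed

section \<open>The Cantor set of numbers with base 4 digits 0 and 1\<close>

fun cantor_stage :: "nat \<Rightarrow> real set" where
  "cantor_stage 0 = {0..1/3}"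
| "cantor_stage (Suc n) = (\<lambda>y. y / 4) ` cantor_stage n \<union> (\<lambda>y. (y + 1) / 4) ` cantor_stage n"

definition quarter_cantor :: "real set" where
  "quarter_cantor = (\<Inter>n. cantor_stage n)"

lemma cantor_stage_subset: "cantor_stage n \<subseteq> {0..1/3}"
  by (induction n) (force simp: image_subset_iff)+

lemma compact_cantor_stage: "compact (cantor_stage n)"
  by (induction n) (auto intro!: compact_Un compact_continuous_image continuous_intros)

lemma compact_quarter_cantor: "compact quarter_cantor"
proof -
  have "closed quarter_cantor" unfolding quarter_cantor_def
    by (intro closed_INT) (auto intro: compact_imp_closed compact_cantor_stage)
  moreover have "bounded quarter_cantor"
  proof (rule bounded_subset)
    show "quarter_cantor \<subseteq> cantor_stage 0" unfolding quarter_cantor_def by blast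
  qed simp
  ultimately show ?thesis by (simp add: compact_eq_bounded_closed)
qed

lemma measure_cantor_stage: "measure lebesgue (cantor_stage n) \<le> (1 / 2) ^ n"
proof (induction n)
  case (Suc n)
  have lm: "cantor_stage m \<in> lmeasurable" for m by (rule lmeasurable_compact[OF compact_cantor_stage])
  have im: "compact ((\<lambda>y. y / 4) ` cantor_stage n)" "compact ((\<lambda>y. (y + 1) / 4) ` cantor_stage n)"
    by (auto intro!: compact_continuous_image continuous_intros compact_cantor_stage)
  have "measure lebesgue (cantor_stage (Suc n))
      \<le> measure lebesgue ((\<lambda>y. y / 4) ` cantor_stage n) + measure lebesgue ((\<lambda>y. (y + 1) / 4) ` cantor_stage n)"
    using im by (simp add: measure_Un_le fmeasurableD lmeasurable_compact)
  also have "measure lebesgue ((\<lambda>y. y / 4) ` cantor_stage n) = measure lebesgue (cantor_stage n) / 4"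
    using measure_lebesgue_affine[of "1/4" 0 "cantor_stage n"] by simp
  also have "measure lebesgue ((\<lambda>y. (y + 1) / 4) ` cantor_stage n) = measure lebesgue (cantor_stage n) / 4"
    using measure_lebesgue_affine[of "1/4" "1/4" "cantor_stage n"] by (simp add: add_divide_distrib)
  finally show ?case using Suc by simp
qed simp

lemma negligible_quarter_cantor: "negligible quarter_cantor"
  unfolding negligible_outer_le
proof (intro allI impI)
  fix e :: real assume "e > 0"
  then obtain n where "(1 / 2 :: real) ^ n < e" using real_arch_pow_inv[of e "1/2"] by auto
  then have "measure lebesgue (cantor_stage n) \<le> e" using measure_cantor_stage[of n] by simp
  then show "\<exists>T. quarter_cantor \<subseteq> T \<and> T \<in> lmeasurable \<and> measure lebesgue T \<le> e"
    using lmeasurable_compact[OF compact_cantor_stage[of n]] unfolding quarter_cantor_def by blast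
qed

text \<open>
  Dropping the first digit is \<open>y \<mapsto> 4 * y - e 0\<close>, which undoes one of the two contractions.
\<close>

lemma sums_in_cantor_stage:
  assumes "\<And>k. e k \<le> (1::nat)" and "(\<lambda>k. real (e k) / 4 ^ Suc k) sums y"
  shows "y \<in> cantor_stage n"
  using assms
proof (induction n arbitrary: e y)
  case 0
  have "(\<lambda>k. (1 / 4) * (1 / 4) ^ k :: real) sums ((1 / 4) * (1 / (1 - 1 / 4)))"
    by (intro sums_mult geometric_sums) simp
  then have geo: "(\<lambda>k. 1 / 4 ^ Suc k :: real) sums (1/3)" by (simp add: power_divide)
  have "real (e k) \<le> 1" for k using 0(1)[of k] by simp
  then have "y \<le> 1/3" by (intro sums_le[OF _ 0(2) geo]) (auto intro: divide_right_mono)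
  moreover have "0 \<le> y" by (intro sums_le[OF _ sums_zero 0(2)]) auto
  ultimately show ?case by simp
next
  case (Suc n)
  have "(\<lambda>k. real (e (Suc k)) / 4 ^ Suc (Suc k)) sums (y - real (e 0) / 4)"
    using Suc.prems(2) by (subst sums_Suc_iff) simp
  from sums_mult[OF this, of 4] have "(\<lambda>k. real (e (Suc k)) / 4 ^ Suc k) sums (4 * y - real (e 0))"
    by (simp add: right_diff_distrib)
  with Suc.prems(1) have IH: "4 * y - real (e 0) \<in> cantor_stage n" by (intro Suc.IH[of "\<lambda>k. e (Suc k)"])
  consider "e 0 = 0" | "e 0 = 1" using Suc.prems(1)[of 0] by linarith
  then show ?case
  proof cases
    case 1
    then have "y = (4 * y - real (e 0)) / 4" by simp
    then have "y \<in> (\<lambda>y. y / 4) ` cantor_stage n" using IH by (rule image_eqI)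
    then show ?thesis by simp
  next
    case 2
    then have "y = ((4 * y - real (e 0)) + 1) / 4" by simp
    then have "y \<in> (\<lambda>y. (y + 1) / 4) ` cantor_stage n" using IH by (rule image_eqI)
    then show ?thesis by simp
  qed
qed

text \<open>
  To read off digits: the two halves of each later stage lie in \<open>{0..1/12}\<close> and \<open>{1/4..1/3}\<close>, so comparing with \<open>1/12\<close> recovers
  the first digit, and the expanding map then takes the Cantor set to itself.
\<close>

lemma quarter_cantor_iff:
  "y \<in> quarter_cantor \<longleftrightarrow> (\<exists>e. (\<forall>k. e k \<le> (1::nat)) \<and> (\<lambda>k. real (e k) / 4 ^ Suc k) sums y)"
proof
  assume "\<exists>e. (\<forall>k. e k \<le> (1::nat)) \<and> (\<lambda>k. real (e k) / 4 ^ Suc k) sums y"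
  then show "y \<in> quarter_cantor" unfolding quarter_cantor_def using sums_in_cantor_stage by blast
next
  assume y: "y \<in> quarter_cantor"
  define digit where "digit w = (if w \<le> 1/12 then 0 else 1 :: nat)" for w :: real
  define T where "T w = 4 * w - real (digit w)" for w
  define z where "z k = (T ^^ k) y" for k
  have stage: "T w \<in> cantor_stage n" if "w \<in> cantor_stage (Suc n)" for w n
  proof -
    obtain v where v: "v \<in> cantor_stage n" "w = v / 4 \<or> w = (v + 1) / 4" using \<open>w \<in> cantor_stage (Suc n)\<close> by auto
    have "0 \<le> v" "v \<le> 1/3" using v(1) cantor_stage_subset by fastforce+
    then have "T w = v" using v(2) unfolding T_def digit_def by auto
    then show ?thesis using v(1) by simp
  qed
  have zA: "z k \<in> quarter_cantor" for k
  proof (induction k)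
    case (Suc k)
    then have "z k \<in> cantor_stage (Suc n)" for n unfolding quarter_cantor_def by blast
    then show ?case using stage unfolding quarter_cantor_def by (simp add: z_def)
  qed (use y in \<open>simp add: z_def\<close>)
  have "(\<lambda>k. real (digit (z k)) / 4 ^ Suc k) sums z 0"
  proof (rule sums_digits_of_orbit)
    show "4 * z k = real (digit (z k)) + z (Suc k)" for k by (simp add: z_def T_def)
    show "\<bar>z k\<bar> \<le> 1" for k
    proof -
      have "z k \<in> {0..1/3}" using zA[of k] cantor_stage_subset[of 0] unfolding quarter_cantor_def by blast
      then show ?thesis by simp
    qed
  qed
  then show "\<exists>e. (\<forall>k. e k \<le> (1::nat)) \<and> (\<lambda>k. real (e k) / 4 ^ Suc k) sums y"
    by (intro exI[of _ "\<lambda>k. digit (z k)"]) (simp add: z_def digit_def)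
qed

text \<open>
  Two different expansions of a number in base 4 involve the digit \<open>3\<close>.
\<close>

lemma zero_one_digits_unique:
  assumes "\<And>k. e k \<le> (1::nat)" "\<And>k. f k \<le> (1::nat)"
    and "(\<lambda>k. real (e k) / 4 ^ Suc k) sums y" "(\<lambda>k. real (f k) / 4 ^ Suc k) sums y"
  shows "e = f"
proof (rule ccontr)
  assume ne: "e \<noteq> f"
  have le3: "e k \<le> 3" "f k \<le> 3" for k using assms(1,2)[of k] by linarith+
  have "expansion4 e y" "expansion4 f y" unfolding expansion4_def using assms le3 by auto
  then obtain k where "(\<forall>j>k. e j = 3 \<and> f j = 0) \<or> (\<forall>j>k. e j = 0 \<and> f j = 3)"
    using expansion4_tails[OF _ _ ne] by blast
  then have "e (Suc k) = 3 \<or> f (Suc k) = 3" by blast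
  then show False using assms(1,2)[of "Suc k"] by auto
qed

text \<open>
  This will turn out to be the set of maximisers over \<open>x\<close>, for \<open>x \<in> {0..1}\<close>.
\<close>

definition cantor_fibre :: "real \<Rightarrow> real set" where
  "cantor_fibre x = {y \<in> quarter_cantor. (x - y) / 2 \<in> quarter_cantor}"

text \<open>
  In \<open>x = 2 * ((x - y) / 2) + y\<close> the digits of \<open>y\<close> are the low bits of base 4 digits of \<open>x\<close>, and those of
  \<open>(x - y) / 2\<close> are the high bits.
\<close>

lemma bij_betw_expansion4_cantor_fibre:
  "bij_betw (\<lambda>q. \<Sum>k. real (q k mod 2) / 4 ^ Suc k) {q. expansion4 q x} (cantor_fibre x)"
  unfolding bij_betw_def
proof
  let ?Y = "\<lambda>q. \<Sum>k. real (q k mod 2) / 4 ^ Suc k"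
  have low: "(\<lambda>k. real (q k mod 2) / 4 ^ Suc k) sums ?Y q" for q :: "nat \<Rightarrow> nat"
  proof (rule summable_sums, rule summable_comparison_test)
    show "summable (\<lambda>k. (1 / 4 :: real) ^ k)" by (rule summable_geometric) simp
    show "\<exists>N. \<forall>k\<ge>N. norm (real (q k mod 2) / 4 ^ Suc k) \<le> (1 / 4) ^ k"
    proof (intro exI allI impI)
      fix k
      have "q k mod 2 < 2" by simp
      then have "real (q k mod 2) \<le> 4" by linarith
      then show "norm (real (q k mod 2) / 4 ^ Suc k) \<le> (1 / 4) ^ k"
        by (simp add: power_divide field_simps)
    qed
  qed
  have high: "(\<lambda>k. real (q k div 2) / 4 ^ Suc k) sums ((x - ?Y q) / 2)" if q: "expansion4 q x" for q
  proof -
    have "(\<lambda>k. real (q k) / 4 ^ Suc k - real (q k mod 2) / 4 ^ Suc k) sums (x - ?Y q)"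
      using q low unfolding expansion4_def by (intro sums_diff) auto
    from sums_divide[OF this, of 2] show ?thesis
    proof (rule sums_cong[THEN iffD1, rotated])
      fix k
      have "real (q k) = 2 * real (q k div 2) + real (q k mod 2)"
        by (metis of_nat_add of_nat_mult of_nat_numeral mult_div_mod_eq)
      then show "(real (q k) / 4 ^ Suc k - real (q k mod 2) / 4 ^ Suc k) / 2 = real (q k div 2) / 4 ^ Suc k"
        by (simp add: field_simps)
    qed
  qed
  have div1: "q k div 2 \<le> 1" if "expansion4 q x" for q k
  proof -
    have "q k \<le> 3" using that unfolding expansion4_def by blast
    then show ?thesis by simp
  qed
  show "inj_on ?Y {q. expansion4 q x}"
  proof (rule inj_onI)
    fix q r assume "q \<in> {q. expansion4 q x}" "r \<in> {q. expansion4 q x}" and eq: "?Y q = ?Y r"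
    then have q: "expansion4 q x" and r: "expansion4 r x" by auto
    have "(\<lambda>k. q k mod 2) = (\<lambda>k. r k mod 2)"
      using zero_one_digits_unique[OF _ _ low low[of r, folded eq]] by simp
    moreover have "(\<lambda>k. q k div 2) = (\<lambda>k. r k div 2)"
      using zero_one_digits_unique[OF div1[OF q] div1[OF r] high[OF q] high[OF r, folded eq]] .
    ultimately show "q = r" by (metis mult_div_mod_eq ext)
  qed
  show "?Y ` {q. expansion4 q x} = cantor_fibre x"
  proof (rule equalityI; rule subsetI)
    fix y assume "y \<in> ?Y ` {q. expansion4 q x}"
    then obtain q where q: "expansion4 q x" "y = ?Y q" by auto
    have "y \<in> quarter_cantor" unfolding quarter_cantor_iff q(2)
      using low[of q] by (intro exI[of _ "\<lambda>k. q k mod 2"]) auto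
    moreover have "(x - y) / 2 \<in> quarter_cantor" unfolding quarter_cantor_iff q(2)
      using high[OF q(1)] div1[OF q(1)] by (intro exI[of _ "\<lambda>k. q k div 2"]) auto
    ultimately show "y \<in> cantor_fibre x" unfolding cantor_fibre_def by simp
  next
    fix y assume "y \<in> cantor_fibre x"
    then have "y \<in> quarter_cantor" "(x - y) / 2 \<in> quarter_cantor" unfolding cantor_fibre_def by auto
    then obtain e f where f: "\<And>k. f k \<le> (1::nat)" "(\<lambda>k. real (f k) / 4 ^ Suc k) sums y"
      and e: "\<And>k. e k \<le> (1::nat)" "(\<lambda>k. real (e k) / 4 ^ Suc k) sums ((x - y) / 2)"
      unfolding quarter_cantor_iff by blast
    define q where "q k = 2 * e k + f k" for k
    have "q k \<le> 3" for k using e(1)[of k] f(1)[of k] unfolding q_def by linarith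
    moreover have "2 * ((x - y) / 2) + y = x" by (simp add: field_simps)
    then have "(\<lambda>k. real (q k) / 4 ^ Suc k) sums x"
      using sums_add[OF sums_mult[OF e(2), of 2] f(2)] by (simp only:) (simp add: q_def add_divide_distrib)
    ultimately have "expansion4 q x" unfolding expansion4_def by simp
    moreover have "q k mod 2 = f k" for k using f(1)[of k] unfolding q_def by simp
    then have "?Y q = y" using f(2) by (simp add: sums_unique[symmetric])
    ultimately show "y \<in> ?Y ` {q. expansion4 q x}" by blast
  qed
qed

lemma cantor_fibre_cardinality:
  assumes x: "x \<in> {0..1}"
  shows "if \<exists>q r. expansion4 q x \<and> expansion4 r x \<and> q \<noteq> r
         then card (cantor_fibre x) = 2 else is_singleton (cantor_fibre x)"
proof -
  let ?Q = "{q. expansion4 q x}"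
  have card_eq: "card (cantor_fibre x) = card ?Q"
    using bij_betw_same_card[OF bij_betw_expansion4_cantor_fibre] by simp
  obtain q where q: "expansion4 q x" using exists_expansion4[OF x] .
  show ?thesis
  proof (cases "\<exists>q r. expansion4 q x \<and> expansion4 r x \<and> q \<noteq> r")
    case True
    then obtain q r where qr: "expansion4 q x" "expansion4 r x" "q \<noteq> r" by blast
    then have "?Q = {q, r}" using expansion4_at_most_two by blast
    then show ?thesis using True card_eq qr(3) by simp
  next
    case False
    then have "?Q = {q}" using q by blast
    then show ?thesis using False card_eq by (simp add: is_singleton_altdef)
  qed
qed

section \<open>The function and its properties\<close>

definition cantor_max_function :: "real \<times> real \<Rightarrow> real" where
  "cantor_max_function z = fst z - 2 * infdist ((fst z - snd z) / 2) quarter_cantor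
     - infdist (snd z) quarter_cantor"

lemma lipschitz_cantor_max_function: "4-lipschitz_on UNIV cantor_max_function"
proof (rule lipschitz_onI)
  fix z w :: "real \<times> real"
  have d: "\<bar>fst z - fst w\<bar> \<le> dist z w" "\<bar>snd z - snd w\<bar> \<le> dist z w"
    using dist_fst_le[of z w] dist_snd_le[of z w] by (simp_all add: dist_real_def)
  have "\<bar>infdist ((fst z - snd z) / 2) quarter_cantor - infdist ((fst w - snd w) / 2) quarter_cantor\<bar>
      \<le> \<bar>(fst z - snd z) / 2 - (fst w - snd w) / 2\<bar>"
    using infdist_triangle_abs by (metis dist_real_def)
  also have "(fst z - snd z) / 2 - (fst w - snd w) / 2 = ((fst z - fst w) - (snd z - snd w)) / 2"
    by (simp add: field_simps)
  also have "\<bar>((fst z - fst w) - (snd z - snd w)) / 2\<bar> = \<bar>(fst z - fst w) - (snd z - snd w)\<bar> / 2"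
    by simp
  also have "\<dots> \<le> dist z w"
    using d abs_triangle_ineq4[of "fst z - fst w" "snd z - snd w"] by simp
  finally have 1: "\<bar>infdist ((fst z - snd z) / 2) quarter_cantor
      - infdist ((fst w - snd w) / 2) quarter_cantor\<bar> \<le> dist z w" .
  have 2: "\<bar>infdist (snd z) quarter_cantor - infdist (snd w) quarter_cantor\<bar> \<le> \<bar>snd z - snd w\<bar>"
    using infdist_triangle_abs by (metis dist_real_def)
  show "dist (cantor_max_function z) (cantor_max_function w) \<le> 4 * dist z w"
    unfolding cantor_max_function_def dist_real_def using 1 2 d by linarith
qed simp

lemma quarter_cantor_nonempty: "quarter_cantor \<noteq> {}"
proof -
  have "0 \<in> quarter_cantor"
    unfolding quarter_cantor_iff by (intro exI[of _ "\<lambda>_. 0"]) simp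
  then show ?thesis by blast
qed

lemma closed_quarter_cantor: "closed quarter_cantor"
  by (rule compact_imp_closed[OF compact_quarter_cantor])

lemma cantor_max_function_le: "cantor_max_function (x, y) \<le> x"
  unfolding cantor_max_function_def
  using infdist_nonneg[of "(x - y) / 2" quarter_cantor] infdist_nonneg[of y quarter_cantor] by simp

lemma cantor_max_function_eq_iff: "cantor_max_function (x, y) = x \<longleftrightarrow> y \<in> cantor_fibre x"
proof -
  have "cantor_max_function (x, y) = x \<longleftrightarrow>
      infdist ((x - y) / 2) quarter_cantor = 0 \<and> infdist y quarter_cantor = 0"
    unfolding cantor_max_function_def
    using infdist_nonneg[of "(x - y) / 2" quarter_cantor] infdist_nonneg[of y quarter_cantor] by auto
  then show ?thesis
    unfolding cantor_fibre_def in_closed_iff_infdist_zero[OF closed_quarter_cantor quarter_cantor_nonempty]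
    by auto
qed

lemma cantor_fibre_nonempty:
  assumes "x \<in> {0..1}"
  shows "cantor_fibre x \<noteq> {}"
proof -
  obtain q where "expansion4 q x" using exists_expansion4[OF assms] .
  then show ?thesis using bij_betw_expansion4_cantor_fibre[of x] by (auto simp: bij_betw_def)
qed

lemma argmax_cantor_max_function:
  assumes "x \<in> {0..1}"
  shows "argmax_set (\<lambda>y. cantor_max_function (x, y)) = cantor_fibre x"
proof -
  obtain w where w: "cantor_max_function (x, w) = x"
    using cantor_fibre_nonempty[OF assms] cantor_max_function_eq_iff by blast
  have "is_arg_max (\<lambda>y. cantor_max_function (x, y)) (\<lambda>_. True) y \<longleftrightarrow> cantor_max_function (x, y) = x" for y
    using w cantor_max_function_le[of x] unfolding is_arg_max_def by (metis less_le not_le)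
  then show ?thesis by (auto simp: argmax_set_def cantor_max_function_eq_iff)
qed

text \<open>
  At \<open>(2 * a + b, b)\<close> the gradient of the function is \<open>0\<close> whenever the distance to the Cantor set has derivative
  \<open>1\<close> at \<open>a\<close> and at \<open>b\<close>.  Such \<open>a\<close> and \<open>b\<close> approximate \<open>(x - y) / 2\<close> and \<open>y\<close>.
\<close>

lemma zero_in_clarke_cantor_max_function:
  assumes "y \<in> cantor_fibre x"
  shows "(0, 0) \<in> clarke_subdifferential cantor_max_function (x, y)"
proof -
  have A: "y \<in> quarter_cantor" "(x - y) / 2 \<in> quarter_cantor"
    using assms unfolding cantor_fibre_def by auto
  have approx: "\<exists>c. \<forall>k. \<bar>c k - a\<bar> < 1 / real (Suc k) \<and>
      ((\<lambda>t. infdist t quarter_cantor) has_real_derivative 1) (at (c k))" if "a \<in> quarter_cantor" for a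
  proof -
    have "\<forall>k. \<exists>c. \<bar>c - a\<bar> < 1 / real (Suc k) \<and>
        ((\<lambda>t. infdist t quarter_cantor) has_real_derivative 1) (at c)"
    proof
      fix k
      show "\<exists>c. \<bar>c - a\<bar> < 1 / real (Suc k) \<and> ((\<lambda>t. infdist t quarter_cantor) has_real_derivative 1) (at c)"
        by (rule exists_derivative_one_infdist[OF closed_quarter_cantor negligible_quarter_cantor that,
              of "1 / real (Suc k)"]) auto
    qed
    then show ?thesis by (rule choice)
  qed
  have lim: "c \<longlonglongrightarrow> a" if "\<forall>k. \<bar>c k - a\<bar> < 1 / real (Suc k)" for c and a :: real
  proof -
    have "\<forall>\<^sub>F k in sequentially. norm (c k - a) \<le> 1 / real (Suc k)"
      using that by (intro always_eventually allI) (simp add: less_imp_le)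
    from Lim_null_comparison[OF this LIMSEQ_Suc[OF lim_1_over_n]] have "(\<lambda>k. c k - a) \<longlonglongrightarrow> 0" .
    then show ?thesis by (rule LIM_zero_cancel)
  qed
  obtain b where b: "\<forall>k. \<bar>b k - y\<bar> < 1 / real (Suc k) \<and>
      ((\<lambda>t. infdist t quarter_cantor) has_real_derivative 1) (at (b k))" using approx[OF A(1)] by blast
  obtain a where a: "\<forall>k. \<bar>a k - (x - y) / 2\<bar> < 1 / real (Suc k) \<and>
      ((\<lambda>t. infdist t quarter_cantor) has_real_derivative 1) (at (a k))" using approx[OF A(2)] by blast
  have "(\<lambda>k. (2 * a k + b k, b k)) \<longlonglongrightarrow> (2 * ((x - y) / 2) + y, y)"
    using a b by (intro tendsto_intros lim) auto
  then have conv: "(\<lambda>k. (2 * a k + b k, b k)) \<longlonglongrightarrow> (x, y)" by (simp add: field_simps)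
  have grad: "GDERIV cantor_max_function (2 * a k + b k, b k) :> (0, 0)" for k
  proof -
    let ?D = "\<lambda>t. infdist t quarter_cantor" and ?z = "(2 * a k + b k, b k)"
    have da: "(?D has_derivative (\<lambda>h. h)) (at ((fst ?z - snd ?z) / 2))"
      using a by (simp add: has_field_derivative_def mult_1[abs_def])
    have db: "(?D has_derivative (\<lambda>h. h)) (at (snd ?z))"
      using b by (simp add: has_field_derivative_def mult_1[abs_def])
    have la: "((\<lambda>z. (fst z - snd z) / 2) has_derivative (\<lambda>h. (fst h - snd h) / 2)) (at ?z)"
      by (auto intro!: derivative_eq_intros)
    have lb: "(snd has_derivative snd) (at ?z)" by (auto intro!: derivative_eq_intros)
    have "(cantor_max_function has_derivative (\<lambda>h. fst h - 2 * ((fst h - snd h) / 2) - snd h)) (at ?z)"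
      unfolding cantor_max_function_def
      by (intro has_derivative_diff has_derivative_mult_right has_derivative_compose[OF la da]
          has_derivative_compose[OF lb db]) (auto intro!: derivative_eq_intros)
    moreover have "(\<lambda>h::real \<times> real. fst h - 2 * ((fst h - snd h) / 2) - snd h) = (\<lambda>h. h \<bullet> (0, 0))"
      by (simp add: fun_eq_iff field_simps inner_prod_def)
    ultimately show ?thesis unfolding gderiv_def by simp
  qed
  show ?thesis unfolding clarke_subdifferential_def
    by (rule hull_inc, rule CollectI, rule exI[of _ "\<lambda>k. (2 * a k + b k, b k)"], rule exI[of _ "\<lambda>_. (0, 0)"])
       (use conv grad in auto)
qed

text \<open>
  The vectors \<open>(1 - s, s - r)\<close>, where \<open>s\<close> and \<open>r\<close> are slopes of the distance at \<open>(x - y) / 2\<close> and \<open>y\<close>: the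
  formula for the gradient.  Solving for \<open>s\<close> and \<open>r\<close> exhibits the graph as a preimage of the closed graph of
  the slopes.
\<close>

definition cantor_field :: "real \<times> real \<Rightarrow> (real \<times> real) set" where
  "cantor_field z = {v. 1 - fst v \<in> distance_slopes quarter_cantor ((fst z - snd z) / 2) \<and>
     1 - fst v - snd v \<in> distance_slopes quarter_cantor (snd z)}"

lemma closed_graph_cantor_field: "closed {(z, v). v \<in> cantor_field z}"
proof -
  let ?G = "{(a, s). s \<in> distance_slopes quarter_cantor a}"
  have "closed ((\<lambda>p. ((fst (fst p) - snd (fst p)) / 2, 1 - fst (snd p))) -` ?G \<inter>
      (\<lambda>p. (snd (fst p), 1 - fst (snd p) - snd (snd p))) -` ?G)"
    by (intro closed_Int closed_vimage closed_distance_slopes compact_quarter_cantor)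
       (auto intro!: continuous_intros)
  then show ?thesis by (rule back_subst[where P = closed]) (auto simp: cantor_field_def)
qed

lemma cantor_field_nonempty: "cantor_field z \<noteq> {}"
proof -
  note ne = distance_slopes_nonempty[OF closed_quarter_cantor quarter_cantor_nonempty]
  obtain s r where "s \<in> distance_slopes quarter_cantor ((fst z - snd z) / 2)"
    "r \<in> distance_slopes quarter_cantor (snd z)" using ne by blast
  then have "(1 - s, s - r) \<in> cantor_field z" unfolding cantor_field_def by simp
  then show ?thesis by blast
qed

lemma bounded_cantor_field: "bounded (\<Union>z\<in>K. cantor_field z)"
proof (rule boundedI)
  fix v assume "v \<in> (\<Union>z\<in>K. cantor_field z)"
  then have "\<bar>1 - fst v\<bar> \<le> 1" "\<bar>1 - fst v - snd v\<bar> \<le> 1"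
    unfolding cantor_field_def distance_slopes_def by auto
  then have "\<bar>fst v\<bar> + \<bar>snd v\<bar> \<le> 4" by linarith
  then show "norm v \<le> 4"
    using norm_Pair_le[of "fst v" "snd v"] by simp
qed

text \<open>
  The derivatives along the curve of its coordinates and of the two distances exist almost everywhere, and
  outside of a further null set they satisfy the chain rule, for every choice of the slopes.  The integrand then
  agrees almost everywhere with a function whose integral is known from the fundamental theorem; in
  particular it is measurable.
\<close>

lemma cantor_max_function_path_integral:
  fixes \<gamma> :: "real \<Rightarrow> real \<times> real"
  assumes ac: "abs_continuous_on_interval 0 1 \<gamma>" and v: "\<forall>t\<in>{0..1}. v t \<in> cantor_field (\<gamma> t)"
  shows "cantor_max_function (\<gamma> 1) = cantor_max_function (\<gamma> 0) +
    (LINT t:{0..1}|lebesgue. vector_derivative \<gamma> (at t within {0..1}) \<bullet> v t)"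
proof -
  let ?A = quarter_cantor
  let ?x = "\<lambda>t. fst (\<gamma> t)" and ?y = "\<lambda>t. snd (\<gamma> t)"
  let ?\<alpha> = "\<lambda>t. (?x t - ?y t) / 2"
  have lip_infdist: "1-lipschitz_on UNIV (\<lambda>a. infdist a ?A)"
    using infdist_triangle_abs[where A = ?A] by (intro lipschitz_onI) (auto simp: dist_real_def)
  have lip_fst: "1-lipschitz_on UNIV (fst :: real \<times> real \<Rightarrow> real)"
    and lip_snd: "1-lipschitz_on UNIV (snd :: real \<times> real \<Rightarrow> real)"
    by (intro lipschitz_onI; simp add: dist_fst_le dist_snd_le)+
  have lip_half: "(1/2)-lipschitz_on UNIV (\<lambda>a::real. a / 2)"
    by (rule lipschitz_onI) (auto simp: dist_real_def simp flip: diff_divide_distrib)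
  note acx = abs_continuous_on_interval_lipschitz_compose[OF ac lip_fst]
  note acy = abs_continuous_on_interval_lipschitz_compose[OF ac lip_snd]
  note ac\<alpha> = abs_continuous_on_interval_lipschitz_compose[OF abs_continuous_on_interval_diff[OF acx acy] lip_half]
  note ac1 = abs_continuous_on_interval_lipschitz_compose[OF ac\<alpha> lip_infdist]
  note ac2 = abs_continuous_on_interval_lipschitz_compose[OF acy lip_infdist]
  obtain x' Nx where x': "x' absolutely_integrable_on {0..1}" "(x' has_integral (?x 1 - ?x 0)) {0..1}"
    "negligible Nx" "\<And>t. t \<in> {0..1} - Nx \<Longrightarrow> (?x has_real_derivative x' t) (at t)"
    using abs_continuous_fundamental_theorem[OF zero_le_one acx] by blast
  obtain y' Ny where y': "y' absolutely_integrable_on {0..1}" "(y' has_integral (?y 1 - ?y 0)) {0..1}"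
    "negligible Ny" "\<And>t. t \<in> {0..1} - Ny \<Longrightarrow> (?y has_real_derivative y' t) (at t)"
    using abs_continuous_fundamental_theorem[OF zero_le_one acy] by blast
  obtain p N1 where p: "p absolutely_integrable_on {0..1}"
    "(p has_integral (infdist (?\<alpha> 1) ?A - infdist (?\<alpha> 0) ?A)) {0..1}"
    "negligible N1" "\<And>t. t \<in> {0..1} - N1 \<Longrightarrow> ((\<lambda>t. infdist (?\<alpha> t) ?A) has_real_derivative p t) (at t)"
    using abs_continuous_fundamental_theorem[OF zero_le_one ac1] by blast
  obtain q N2 where q: "q absolutely_integrable_on {0..1}"
    "(q has_integral (infdist (?y 1) ?A - infdist (?y 0) ?A)) {0..1}"
    "negligible N2" "\<And>t. t \<in> {0..1} - N2 \<Longrightarrow> ((\<lambda>t. infdist (?y t) ?A) has_real_derivative q t) (at t)"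
    using abs_continuous_fundamental_theorem[OF zero_le_one ac2] by blast
  define h where "h t = x' t - 2 * p t - q t" for t
  have h_int: "h absolutely_integrable_on {0..1}"
    unfolding h_def using x'(1) p(1) q(1) by (intro set_integral_diff set_integrable_mult_right)
  have "(h has_integral ((?x 1 - ?x 0) - 2 * (infdist (?\<alpha> 1) ?A - infdist (?\<alpha> 0) ?A)
      - (infdist (?y 1) ?A - infdist (?y 0) ?A))) {0..1}"
    unfolding h_def by (intro has_integral_diff has_integral_mult_right x'(2) p(2) q(2))
  then have "(h has_integral (cantor_max_function (\<gamma> 1) - cantor_max_function (\<gamma> 0))) {0..1}"
    by (simp add: cantor_max_function_def algebra_simps)
  then have total: "(LINT t:{0..1}|lebesgue. h t) = cantor_max_function (\<gamma> 1) - cantor_max_function (\<gamma> 0)"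
    using set_lebesgue_integral_eq_integral(2)[OF h_int] by (simp add: integral_unique)
  have \<alpha>': "(?\<alpha> has_real_derivative (x' t - y' t) / 2) (at t)" if "t \<in> {0..1} - (Nx \<union> Ny)" for t
    using x'(4)[of t] y'(4)[of t] that by (intro DERIV_cdivide DERIV_diff) auto
  define Z where "Z = {t \<in> {0..1} - (Nx \<union> Ny). ?\<alpha> t \<in> ?A \<and> (x' t - y' t) / 2 \<noteq> 0} \<union>
      {t \<in> {0..1} - Ny. ?y t \<in> ?A \<and> y' t \<noteq> 0}"
  have "negligible Z" unfolding Z_def
    by (intro negligible_Un negligible_nonzero_derivative_preimage[OF negligible_quarter_cantor] \<alpha>' y'(4))
  define N where "N = Nx \<union> Ny \<union> N1 \<union> N2 \<union> Z"
  have N: "negligible N" unfolding N_def using x'(3) y'(3) p(3) q(3) \<open>negligible Z\<close> by simp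
  have ae: "h t = vector_derivative \<gamma> (at t within {0..1}) \<bullet> v t" if t: "t \<in> {0..1} - N" for t
  proof -
    have tx: "t \<in> {0..1} - Nx" and ty: "t \<in> {0..1} - Ny" and t1: "t \<in> {0..1} - N1"
      and t2: "t \<in> {0..1} - N2" and txy: "t \<in> {0..1} - (Nx \<union> Ny)" and tZ: "t \<notin> Z"
      using t unfolding N_def by auto
    have "((\<lambda>t. (?x t, ?y t)) has_vector_derivative (x' t, y' t)) (at t within {0..1})"
      using x'(4)[OF tx] y'(4)[OF ty]
      by (intro has_vector_derivative_Pair)
         (auto simp: has_real_derivative_iff_has_vector_derivative intro: has_vector_derivative_at_within)
    then have vd: "vector_derivative \<gamma> (at t within {0..1}) = (x' t, y' t)"
      using t by (intro vector_derivative_within_closed_interval) auto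
    have s: "1 - fst (v t) \<in> distance_slopes ?A (?\<alpha> t)" and r: "1 - fst (v t) - snd (v t) \<in> distance_slopes ?A (?y t)"
      using v t unfolding cantor_field_def by auto
    have "p t = (1 - fst (v t)) * ((x' t - y' t) / 2)"
      by (rule distance_slopes_chain_rule[OF \<alpha>'[OF txy] p(4)[OF t1] s]) (use tZ txy in \<open>auto simp: Z_def\<close>)
    moreover have "q t = (1 - fst (v t) - snd (v t)) * y' t"
      by (rule distance_slopes_chain_rule[OF y'(4)[OF ty] q(4)[OF t2] r]) (use tZ ty in \<open>auto simp: Z_def\<close>)
    ultimately have "h t = x' t * fst (v t) + y' t * snd (v t)"
      unfolding h_def by (simp add: algebra_simps)
    then show ?thesis unfolding vd by (simp add: inner_prod_def)
  qed
  let ?I = "\<lambda>t. indicator {0..1} t *\<^sub>R (vector_derivative \<gamma> (at t within {0..1}) \<bullet> v t)"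
  have AE: "AE t in lebesgue. indicator {0..1} t *\<^sub>R h t = ?I t"
  proof (rule AE_I'[of N])
    show "N \<in> null_sets lebesgue" using N negligible_iff_null_sets by blast
    show "{t \<in> space lebesgue. indicator {0..1} t *\<^sub>R h t \<noteq> ?I t} \<subseteq> N"
      using ae by (auto simp: indicator_def split: if_splits)
  qed
  have meas: "(\<lambda>t. indicator {0..1} t *\<^sub>R h t) \<in> borel_measurable lebesgue"
    using h_int unfolding set_integrable_def by (rule borel_measurable_integrable)
  have "(LINT t:{0..1}|lebesgue. h t)
      = (LINT t:{0..1}|lebesgue. vector_derivative \<gamma> (at t within {0..1}) \<bullet> v t)"
    unfolding set_lebesgue_integral_def
    by (intro integral_cong_AE meas borel_measurable_AE[OF meas AE] AE)
  then show ?thesis using total by simp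
qed

lemma path_differentiable_cantor_max_function: "path_differentiable cantor_max_function"
  unfolding path_differentiable_def
proof (intro conjI exI[of _ cantor_field] allI impI)
  show "locally_Lipschitz cantor_max_function"
    unfolding locally_Lipschitz_def
    using lipschitz_on_subset[OF lipschitz_cantor_max_function] by (meson subset_UNIV zero_less_one)
  show "closed {(z, v). v \<in> cantor_field z}" by (rule closed_graph_cantor_field)
  show "cantor_field z \<noteq> {}" for z by (rule cantor_field_nonempty)
  show "bounded (\<Union>z\<in>K. cantor_field z)" for K by (rule bounded_cantor_field)
next
  fix z \<gamma> v
  assume "abs_continuous_on_interval 0 1 \<gamma>" "\<gamma> 0 = 0" "\<gamma> 1 = z"
    and "\<forall>t\<in>{0..1}. v t \<in> cantor_field (\<gamma> t)"
  then show "cantor_max_function z = cantor_max_function 0 +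
      (LINT t:{0..1}|lebesgue. vector_derivative \<gamma> (at t within {0..1}) \<bullet> v t)"
    using cantor_max_function_path_integral[of \<gamma> v] by simp
qed

theorem theorem5:
  shows "\<exists>g :: real \<times> real \<Rightarrow> real.
    (\<exists>L. L-lipschitz_on UNIV g) \<and>
    path_differentiable g \<and>
    (\<forall>x\<in>{0..1}. (\<forall>y. g (x, y) \<le> x) \<and> (\<exists>y\<in>{0..1}. g (x, y) = x)) \<and>
    (\<forall>x\<in>{0..1}. 0 \<in> {v::real. \<exists>y\<in>argmax_set (\<lambda>z. g (x, z)).
                                  (v, 0) \<in> clarke_subdifferential g (x, y)}) \<and>
    (\<exists>S\<subseteq>{0..1}. countable S \<and> infinite S \<and>
       (\<forall>x\<in>S. card (argmax_set (\<lambda>y. g (x, y))) = 2) \<and>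
       (\<forall>x\<in>{0..1} - S. is_singleton (argmax_set (\<lambda>y. g (x, y)))))"
proof (intro exI[of _ cantor_max_function] conjI ballI)
  show "\<exists>L. L-lipschitz_on UNIV cantor_max_function" using lipschitz_cantor_max_function by blast
  show "path_differentiable cantor_max_function" by (rule path_differentiable_cantor_max_function)
next
  fix x :: real assume x: "x \<in> {0..1}"
  show "\<forall>y. cantor_max_function (x, y) \<le> x" using cantor_max_function_le by blast
  obtain y where y: "y \<in> cantor_fibre x" using cantor_fibre_nonempty[OF x] by blast
  have "y \<in> cantor_stage 0" using y unfolding cantor_fibre_def quarter_cantor_def by blast
  then show "\<exists>y\<in>{0..1}. cantor_max_function (x, y) = x"
    using y cantor_max_function_eq_iff by (intro bexI[of _ y]) auto
  show "0 \<in> {v. \<exists>y\<in>argmax_set (\<lambda>z. cantor_max_function (x, z)).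
      (v, 0) \<in> clarke_subdifferential cantor_max_function (x, y)}"
    using y zero_in_clarke_cantor_max_function argmax_cantor_max_function[OF x] by blast
next
  define S where "S = {x \<in> {0..1}. \<exists>q r. expansion4 q x \<and> expansion4 r x \<and> q \<noteq> r}"
  show "\<exists>S\<subseteq>{0..1}. countable S \<and> infinite S \<and>
       (\<forall>x\<in>S. card (argmax_set (\<lambda>y. cantor_max_function (x, y))) = 2) \<and>
       (\<forall>x\<in>{0..1} - S. is_singleton (argmax_set (\<lambda>y. cantor_max_function (x, y))))"
  proof (intro exI[of _ S] conjI ballI)
    show "S \<subseteq> {0..1}" unfolding S_def by blast
    show "countable S"
      by (rule countable_subset[OF _ countable_two_expansions]) (auto simp: S_def)
    have "inj (\<lambda>n::nat. 1 / 4 ^ Suc n :: real)" by (auto intro!: injI)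
    moreover have "range (\<lambda>n::nat. 1 / 4 ^ Suc n :: real) \<subseteq> S"
      using two_expansions_inverse_power unfolding S_def
      by (auto simp del: power_Suc simp: divide_le_eq)
    ultimately show "infinite S" by (meson finite_subset range_inj_infinite)
    show "card (argmax_set (\<lambda>y. cantor_max_function (x, y))) = 2" if "x \<in> S" for x
      using that cantor_fibre_cardinality[of x] argmax_cantor_max_function[of x] unfolding S_def by auto
    show "is_singleton (argmax_set (\<lambda>y. cantor_max_function (x, y)))" if "x \<in> {0..1} - S" for x
      using that cantor_fibre_cardinality[of x] argmax_cantor_max_function[of x] unfolding S_def
      by (auto split: if_splits)
  qed
qed

end
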